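(* Let $G=(V,E)$ be an interval graph, let $Q_1,Q_2,\dots,Q_r$ be a linear ordering of the maximal cliques of $G$ such that for every vertex $v$ the maximal cliques containing $v$ occur consecutively, and let $H_G$ be the canonical interval representation of $G$ constructed from this ordering (as described in the context). Then $G$ is exactly hittable if and only if $H_G$ is exactly hittable, i.e. there is a set $T$ of points with $|T\cap J(v)|=1$ for every $v\in V$.
   Context: An interval representation of a graph $G=(V,E)$ is a family of intervals of consecutive integers $\{I(v)\}_{v\in V}$ with $uv\in E$ iff $I(u)\cap I(v)\ne\emptyset$ for distinct $u,v$. An interval graph is exactly hittable if it has an interval representation $\{I(v)\}$ admitting a set $T$ of integers with $|T\cap I(v)|=1$ for all $v$. Canonical interval representation: given the ordering $Q_1,\dots,Q_r$, let $l(v)$ (resp. $r(v)$) be the index of the first (resp. last) maximal clique containing $v$. For each $i$, let $L_i=\{v: l(v)=i\}$ listed as $v_1,\dots,v_{t}$ in decreasing order of $r(v)$, and $R_i=\{v: r(v)=i\}$ listed as $w_1,\dots,w_{s}$ in increasing order of $l(v)$ (ties broken arbitrarily). Gadget $D_i$ is a block of consecutive integer points with a distinguished point $z_i$ (its zero point), consisting of the points $z_i-(t-1),\dots,z_i,\dots,z_i+(s-1)$. The gadgets $D_1,\dots,D_r$ are placed left to right on the integer line in this order, with exactly one additional integer point between each pair of consecutive gadgets. For each vertex $v$, the stretched interval $J(v)$ is the set of all integer points from its left endpoint to its right endpoint, where the left endpoint is $z_{l(v)}-k+1$ if $v$ is the $k$-th vertex in the list of $L_{l(v)}$, and the right endpoint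 is $z_{r(v)}+k-1$ if $v$ is the $k$-th vertex in the list of $R_{r(v)}$. $H_G$ is the interval hypergraph whose vertex set is the set of all points of the gadgets together with the $r-1$ additional points, and whose hyperedges are the intervals $J(v)$, $v\in V$. *)

theory Defs
  imports Main
begin

definition finite_simple_graph :: "'a set \<Rightarrow> 'a set set \<Rightarrow> bool" where
  "finite_simple_graph V E \<longleftrightarrow> finite V \<and> (\<forall>e\<in>E. e \<subseteq> V \<and> card e = 2)"

definition integer_interval :: "int set \<Rightarrow> bool" where
  "integer_interval S \<longleftrightarrow> (\<exists>a b. a \<le> b \<and> S = {a..b})"

definition interval_representation ::
    "'a set \<Rightarrow> 'a set set \<Rightarrow> ('a \<Rightarrow> int set) \<Rightarrow> bool" where
  "interval_representation V E I \<longleftrightarrow>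
     (\<forall>v\<in>V. integer_interval (I v)) \<and>
     (\<forall>u\<in>V. \<forall>v\<in>V. u \<noteq> v \<longrightarrow> ({u, v} \<in> E \<longleftrightarrow> I u \<inter> I v \<noteq> {}))"

definition interval_graph :: "'a set \<Rightarrow> 'a set set \<Rightarrow> bool" where
  "interval_graph V E \<longleftrightarrow> (\<exists>I. interval_representation V E I)"

text \<open>A hypergraph is given by its vertex set \<open>X\<close> and its set \<open>F\<close> of hyperedges.\<close>

definition exactly_hittable_hypergraph :: "'p set \<Rightarrow> 'p set set \<Rightarrow> bool" where
  "exactly_hittable_hypergraph X F \<longleftrightarrow> (\<exists>T\<subseteq>X. \<forall>e\<in>F. card (T \<inter> e) = 1)"

definition exactly_hittable_graph :: "'a set \<Rightarrow> 'a set set \<Rightarrow> bool" where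
  "exactly_hittable_graph V E \<longleftrightarrow>
     (\<exists>I T. interval_representation V E I \<and> (\<forall>v\<in>V. card (T \<inter> I v) = 1))"

definition clique :: "'a set \<Rightarrow> 'a set set \<Rightarrow> 'a set \<Rightarrow> bool" where
  "clique V E C \<longleftrightarrow> C \<subseteq> V \<and> (\<forall>u\<in>C. \<forall>v\<in>C. u \<noteq> v \<longrightarrow> {u, v} \<in> E)"

definition maximal_clique :: "'a set \<Rightarrow> 'a set set \<Rightarrow> 'a set \<Rightarrow> bool" where
  "maximal_clique V E C \<longleftrightarrow> clique V E C \<and> (\<forall>D. clique V E D \<and> C \<subseteq> D \<longrightarrow> D = C)"

definition consecutive_clique_ordering ::
    "'a set \<Rightarrow> 'a set set \<Rightarrow> nat \<Rightarrow> (nat \<Rightarrow> 'a set) \<Rightarrow> bool" where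
  "consecutive_clique_ordering V E r Q \<longleftrightarrow>
     bij_betw Q {1..r} {C. maximal_clique V E C} \<and>
     (\<forall>v\<in>V. \<forall>i j k. 1 \<le> i \<and> i \<le> j \<and> j \<le> k \<and> k \<le> r \<and> v \<in> Q i \<and> v \<in> Q k \<longrightarrow> v \<in> Q j)"

definition first_clique :: "nat \<Rightarrow> (nat \<Rightarrow> 'a set) \<Rightarrow> 'a \<Rightarrow> nat" where
  "first_clique r Q v = Min {i \<in> {1..r}. v \<in> Q i}"

definition last_clique :: "nat \<Rightarrow> (nat \<Rightarrow> 'a set) \<Rightarrow> 'a \<Rightarrow> nat" where
  "last_clique r Q v = Max {i \<in> {1..r}. v \<in> Q i}"

text \<open>Ties may be broken in any way, so the lists \<open>L i\<close> and \<open>R i\<close> are characterised by a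
  predicate rather than chosen.\<close>

definition start_lists ::
    "'a set \<Rightarrow> nat \<Rightarrow> (nat \<Rightarrow> 'a set) \<Rightarrow> (nat \<Rightarrow> 'a list) \<Rightarrow> bool" where
  "start_lists V r Q L \<longleftrightarrow>
     (\<forall>i\<in>{1..r}. distinct (L i) \<and> set (L i) = {v \<in> V. first_clique r Q v = i} \<and>
        sorted_wrt (\<lambda>u v. last_clique r Q u \<ge> last_clique r Q v) (L i))"

definition end_lists ::
    "'a set \<Rightarrow> nat \<Rightarrow> (nat \<Rightarrow> 'a set) \<Rightarrow> (nat \<Rightarrow> 'a list) \<Rightarrow> bool" where
  "end_lists V r Q R \<longleftrightarrow>
     (\<forall>i\<in>{1..r}. distinct (R i) \<and> set (R i) = {v \<in> V. last_clique r Q v = i} \<and>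
        sorted_wrt (\<lambda>u v. first_clique r Q u \<le> first_clique r Q v) (R i))"

definition gadget_left :: "(nat \<Rightarrow> 'a list) \<Rightarrow> (nat \<Rightarrow> int) \<Rightarrow> nat \<Rightarrow> int" where
  "gadget_left L z i = z i - (int (length (L i)) - 1)"

definition gadget_right :: "(nat \<Rightarrow> 'a list) \<Rightarrow> (nat \<Rightarrow> int) \<Rightarrow> nat \<Rightarrow> int" where
  "gadget_right R z i = z i + (int (length (R i)) - 1)"

definition gadget ::
    "(nat \<Rightarrow> 'a list) \<Rightarrow> (nat \<Rightarrow> 'a list) \<Rightarrow> (nat \<Rightarrow> int) \<Rightarrow> nat \<Rightarrow> int set" where
  "gadget L R z i = {gadget_left L z i..gadget_right R z i}"

text \<open>\<open>z i\<close> is the zero point of the \<open>i\<close>-th gadget. The condition says that exactly one integer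
  lies between consecutive gadgets; the position of the first gadget is left free.\<close>

definition gadget_placement ::
    "nat \<Rightarrow> (nat \<Rightarrow> 'a list) \<Rightarrow> (nat \<Rightarrow> 'a list) \<Rightarrow> (nat \<Rightarrow> int) \<Rightarrow> bool" where
  "gadget_placement r L R z \<longleftrightarrow>
     (\<forall>i\<in>{1..<r}. gadget_left L z (i + 1) = gadget_right R z i + 2)"

text \<open>Counted from 1; only meaningful for members of the list.\<close>

definition list_position :: "'a list \<Rightarrow> 'a \<Rightarrow> nat" where
  "list_position xs v = length (takeWhile (\<lambda>u. u \<noteq> v) xs) + 1"

definition stretched_interval ::
    "nat \<Rightarrow> (nat \<Rightarrow> 'a set) \<Rightarrow> (nat \<Rightarrow> 'a list) \<Rightarrow> (nat \<Rightarrow> 'a list) \<Rightarrow> (nat \<Rightarrow> int) \<Rightarrow> 'a \<Rightarrow> int set"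
  where
  "stretched_interval r Q L R z v =
     {z (first_clique r Q v) - int (list_position (L (first_clique r Q v)) v) + 1 ..
      z (last_clique r Q v) + int (list_position (R (last_clique r Q v)) v) - 1}"

definition canonical_points ::
    "nat \<Rightarrow> (nat \<Rightarrow> 'a list) \<Rightarrow> (nat \<Rightarrow> 'a list) \<Rightarrow> (nat \<Rightarrow> int) \<Rightarrow> int set" where
  "canonical_points r L R z =
     (\<Union>i\<in>{1..r}. gadget L R z i) \<union> {gadget_right R z i + 1 | i. i \<in> {1..<r}}"

definition canonical_hyperedges ::
    "'a set \<Rightarrow> nat \<Rightarrow> (nat \<Rightarrow> 'a set) \<Rightarrow> (nat \<Rightarrow> 'a list) \<Rightarrow> (nat \<Rightarrow> 'a list) \<Rightarrow> (nat \<Rightarrow> int)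
       \<Rightarrow> int set set" where
  "canonical_hyperedges V r Q L R z = stretched_interval r Q L R z ` V"

end

theory Submission
  imports Defs
begin

text \<open>
  An exact hitting set of some representation of \<open>G\<close> sorts the vertices into levels \<open>c\<close>: each level
  is a clique, and adjacent vertices differ by at most one level. Conversely the stretched
  intervals are exactly hittable once there is a labelling \<open>f\<close> of the vertices that is strictly
  increasing along disjoint intervals, weakly increasing along both endpoint orders of the clique
  intervals, constant on strictly nested ones, and changes by at most one along edges. The given
  clique ordering may disagree with the levels \<open>c\<close> (a representation may permute the leaves of
  a claw), so \<open>c\<close> itself need not be such a labelling.

  The labelling conditions form a system of difference constraints, solved by longest walks
  provided that the walks have bounded weight. All compositions of two constraints are implied by
  a single one, except for runs of \<open>+1\<close>, runs of \<open>-1\<close>, and some turns at vertices that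
  take part in a strict nesting. If \<open>a\<close> is strictly nested in \<open>b\<close>, then \<open>a\<close> is the middle leaf
  of a claw centred at \<open>b\<close>, whose three leaves occupy the levels \<open>c b - 1\<close>, \<open>c b\<close>, \<open>c b + 1\<close> in
  some order. In a connected graph the levels of the claw centres are therefore, up to one global
  sign, compatible with the clique ordering, and this bounds the weight of every walk.
\<close>

subsection \<open>Longest walks\<close>

locale spans =
  fixes V :: "'a set" and l r :: "'a \<Rightarrow> int"
  assumes finite_V: "finite V"
    and span: "v \<in> V \<Longrightarrow> l v \<le> r v"
begin

definition meets :: "'a \<Rightarrow> 'a \<Rightarrow> bool" where
  "meets u v \<longleftrightarrow> l u \<le> r v \<and> l v \<le> r u"

definition nested :: "'a \<Rightarrow> 'a \<Rightarrow> bool" where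
  "nested a b \<longleftrightarrow> a \<in> V \<and> b \<in> V \<and> l b < l a \<and> r a < r b"

definition core :: "'a \<Rightarrow> bool" where
  "core s \<longleftrightarrow> (\<exists>a. nested a s) \<or> (\<exists>b. nested s b)"

definition left_of :: "'a \<Rightarrow> 'a \<Rightarrow> bool" where
  "left_of u v \<longleftrightarrow> l u \<le> l v \<and> r u \<le> r v"

text \<open>A chain composes \<open>m\<close> strict increases and has weight \<open>m\<close>; a
  \<open>walk\<close> composes \<open>k\<close> steps along edges, each of which may lower the label
  by one, and has weight \<open>-k\<close>.\<close>

inductive chain :: "nat \<Rightarrow> 'a \<Rightarrow> 'a \<Rightarrow> bool" where
  chain_0: "v \<in> V \<Longrightarrow> chain 0 v v"
| chain_Suc: "chain m u v \<Longrightarrow> w \<in> V \<Longrightarrow> r v < l w \<Longrightarrow> chain (Suc m) u w"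

inductive walk :: "nat \<Rightarrow> 'a \<Rightarrow> 'a \<Rightarrow> bool" where
  walk_0: "v \<in> V \<Longrightarrow> walk 0 v v"
| walk_Suc: "walk k u v \<Longrightarrow> w \<in> V \<Longrightarrow> meets v w \<Longrightarrow> walk (Suc k) u w"

inductive_cases chain_0E: "chain 0 u v"
inductive_cases chain_SucE: "chain (Suc m) u v"
inductive_cases walk_0E: "walk 0 u v"
inductive_cases walk_SucE: "walk (Suc k) u v"

lemma chain_mem: "chain m u v \<Longrightarrow> u \<in> V \<and> v \<in> V"
  by (induction rule: chain.induct) auto

lemma walk_mem: "walk k u v \<Longrightarrow> u \<in> V \<and> v \<in> V"
  by (induction rule: walk.induct) auto

lemma chain_length: "chain m u v \<Longrightarrow> int m \<le> l v - l u"
proof (induction rule: chain.induct)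
  case (chain_Suc m u v w)
  then show ?case using span[of v] chain_mem[of m u v] by auto
qed auto

lemma chain_before: "chain (Suc m) u v \<Longrightarrow> r u < l v"
proof (induction m arbitrary: v)
  case 0
  then show ?case by (auto elim!: chain_SucE chain_0E)
next
  case (Suc m)
  from Suc.prems obtain w where w: "chain (Suc m) u w" "v \<in> V" "r w < l v"
    by (auto elim: chain_SucE)
  with Suc.IH[of w] span[of w] chain_mem[of "Suc m" u w] show ?case by auto
qed

text \<open>Only the right end of the first vertex matters to its successor. The index is positive
  because a chain of length 0 identifies both ends.\<close>

lemma chain_start: "chain (Suc m) u v \<Longrightarrow> u' \<in> V \<Longrightarrow> r u' \<le> r u \<Longrightarrow> chain (Suc m) u' v"
proof (induction m arbitrary: v)
  case 0
  then show ?case by (auto elim!: chain_SucE chain_0E intro!: chain.intros)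
next
  case (Suc m)
  from Suc.prems(1) show ?case
    by (rule chain_SucE) (use Suc in \<open>auto intro: chain_Suc\<close>)
qed

lemma chain_prepend: "chain m u v \<Longrightarrow> t \<in> V \<Longrightarrow> r t < l u \<Longrightarrow> chain (Suc m) t v"
  by (induction rule: chain.induct) (auto intro: chain.intros)

lemma walk_start:
  "walk (Suc k) u v \<Longrightarrow> u' \<in> V \<Longrightarrow> l u' \<le> l u \<Longrightarrow> r u \<le> r u' \<Longrightarrow> walk (Suc k) u' v"
proof (induction k arbitrary: v)
  case 0
  then show ?case by (auto elim!: walk_SucE walk_0E intro!: walk.intros simp: meets_def)
next
  case (Suc k)
  from Suc.prems(1) show ?case
    by (rule walk_SucE) (use Suc in \<open>auto intro: walk_Suc\<close>)
qed

end

section \<open>Difference constraints and a potential on the strictly nested vertices\<close>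

definition order_labelling :: "'a set \<Rightarrow> ('a \<Rightarrow> int) \<Rightarrow> ('a \<Rightarrow> int) \<Rightarrow> ('a \<Rightarrow> int) \<Rightarrow> bool" where
  "order_labelling V l r f \<longleftrightarrow> (\<forall>u\<in>V. \<forall>v\<in>V.
     (r u < l v \<longrightarrow> f u < f v) \<and>
     (l u \<le> r v \<and> l v \<le> r u \<longrightarrow> f u \<le> f v + 1) \<and>
     (l u \<le> l v \<and> r u \<le> r v \<longrightarrow> f u \<le> f v) \<and>
     (l v < l u \<and> r u < r v \<longrightarrow> f u = f v))"

text \<open>A certificate that each piece of a constraint walk between two vertices of
  \<open>core\<close> gains at most the difference of \<open>\<psi>\<close>. Only
  \<open>core\<close> is constrained: elsewhere consecutive steps can be contracted.\<close>

locale core_potential = spans V l r for V :: "'a set" and l r :: "'a \<Rightarrow> int" +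
  fixes \<psi> :: "'a \<Rightarrow> int"
  assumes psi_nested: "nested a b \<Longrightarrow> \<psi> a = \<psi> b"
    and psi_left_of: "core s \<Longrightarrow> core t \<Longrightarrow> left_of s t \<Longrightarrow> \<psi> s \<le> \<psi> t"
    and psi_chain: "core s \<Longrightarrow> core t \<Longrightarrow> chain m s t \<Longrightarrow> \<psi> s + int m \<le> \<psi> t"
    and psi_walk: "core s \<Longrightarrow> core t \<Longrightarrow> walk k s t \<Longrightarrow> \<psi> s - int k \<le> \<psi> t"
begin

text \<open>Each rule reads one constraint of \<open>order_labelling\<close> as a lower bound at
  \<open>v\<close>. The values \<open>x\<close> are the weights of the constraint walks ending at
  \<open>v\<close>, so every nonnegative labelling is at least \<open>x\<close> there.\<close>

inductive forced :: "'a \<Rightarrow> int \<Rightarrow> bool" where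
  start: "v \<in> V \<Longrightarrow> forced v 0"
| before: "forced u x \<Longrightarrow> v \<in> V \<Longrightarrow> r u < l v \<Longrightarrow> forced v (x + 1)"
| left: "forced u x \<Longrightarrow> v \<in> V \<Longrightarrow> left_of u v \<Longrightarrow> forced v x"
| inside: "forced u x \<Longrightarrow> nested v u \<Longrightarrow> forced v x"
| outside: "forced u x \<Longrightarrow> nested u v \<Longrightarrow> forced v x"
| meet: "forced u x \<Longrightarrow> v \<in> V \<Longrightarrow> meets u v \<Longrightarrow> forced v (x - 1)"

definition zero :: "'a \<Rightarrow> 'a \<Rightarrow> bool" where
  "zero u v \<longleftrightarrow> left_of u v \<or> nested u v \<or> nested v u"

text \<open>A restart point of the normal form: the last vertex of \<open>core\<close> visited, with
  its weight bounded by the shifted potential, or else the beginning of the walk, with weight at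
  most 0.\<close>

definition source :: "int \<Rightarrow> 'a \<Rightarrow> int \<Rightarrow> bool" where
  "source K s b \<longleftrightarrow> s \<in> V \<and> (if core s then b \<le> \<psi> s + K else b \<le> 0)"

text \<open>The normal form of a walk: since its last visit to \<open>core\<close> it is a run of \<open>+1\<close> steps, a run
  of \<open>-1\<close> steps, or a single step of weight \<open>0\<close>.\<close>

definition reaches :: "int \<Rightarrow> 'a \<Rightarrow> int \<Rightarrow> bool" where
  "reaches K v x \<longleftrightarrow> v \<in> V \<and> (\<exists>s b. source K s b \<and>
     ((\<exists>m. chain m s v \<and> x \<le> b + int m) \<or> (zero s v \<and> x \<le> b) \<or> (\<exists>k. walk k s v \<and> x \<le> b - int k)))"

lemma reaches_chain: "source K s b \<Longrightarrow> chain m s v \<Longrightarrow> x \<le> b + int m \<Longrightarrow> reaches K v x"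
  unfolding reaches_def using chain_mem by blast

lemma reaches_walk: "source K s b \<Longrightarrow> walk k s v \<Longrightarrow> x \<le> b - int k \<Longrightarrow> reaches K v x"
  unfolding reaches_def using walk_mem by blast

lemma reaches_zero: "source K s b \<Longrightarrow> zero s v \<Longrightarrow> v \<in> V \<Longrightarrow> x \<le> b \<Longrightarrow> reaches K v x"
  unfolding reaches_def by blast

lemma reaches_mono: "reaches K v y \<Longrightarrow> x \<le> y \<Longrightarrow> reaches K v x"
  unfolding reaches_def by (meson order_trans)

lemma core_nested: "nested a b \<Longrightarrow> core a" "nested a b \<Longrightarrow> core b"
  by (auto simp: core_def)

section \<open>Bounded weight of constraint walks\<close>

context
  fixes N K :: int
  assumes N: "\<And>u v. u \<in> V \<Longrightarrow> v \<in> V \<Longrightarrow> l v - l u \<le> N"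
    and K: "\<And>v. v \<in> V \<Longrightarrow> N \<le> \<psi> v + K"
begin

text \<open>Every arrival in \<open>core\<close> is a new restart point. From a core source the
  potential bounds the gain; from any other source the weight is at most the chain bound
  \<open>N\<close>, which the shift \<open>K\<close> absorbs.\<close>

lemma reaches_core:
  assumes "reaches K v x" "core v"
  shows "source K v x"
proof -
  obtain s b where sb: "source K s b" and v: "v \<in> V"
    and alt: "(\<exists>m. chain m s v \<and> x \<le> b + int m) \<or> (zero s v \<and> x \<le> b) \<or> (\<exists>k. walk k s v \<and> x \<le> b - int k)"
    using assms(1) by (auto simp: reaches_def)
  have s: "s \<in> V" using sb by (simp add: source_def)
  have N0: "0 \<le> N" using N[OF s s] by simp
  have "x \<le> \<psi> v + K"
  proof (cases "core s")
    case True
    then have b: "b \<le> \<psi> s + K" using sb by (simp add: source_def)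
    have "zero s v \<Longrightarrow> \<psi> s \<le> \<psi> v"
      using psi_nested psi_left_of[OF True assms(2)] by (auto simp: zero_def)
    then show ?thesis using alt b psi_chain[OF True assms(2)] psi_walk[OF True assms(2)] by fastforce
  next
    case False
    then have "b \<le> 0" using sb by (simp add: source_def)
    moreover have "int m \<le> N" if "chain m s v" for m
      using chain_length[OF that] N[OF s v] by simp
    ultimately have "x \<le> N" using alt N0 by fastforce
    then show ?thesis using K[OF v] by simp
  qed
  then show ?thesis using v assms(2) by (simp add: source_def)
qed

text \<open>Contracts a run of \<open>-1\<close> steps followed by a \<open>0\<close> or
  \<open>+1\<close> step by going back along the run. The induction is simultaneous because each
  claim uses the other at the preceding vertex.\<close>

lemma reaches_walk_step:
  assumes "source K s b"
  shows "walk k s t \<Longrightarrow> v \<in> V \<Longrightarrow> left_of t v \<Longrightarrow> reaches K v (b - int k)"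
    and "walk k s t \<Longrightarrow> v \<in> V \<Longrightarrow> r t < l v \<Longrightarrow> reaches K v (b - int k + 1)"
proof (induction k arbitrary: t v)
  case 0
  {
    case 1
    then show ?case using assms by (auto elim!: walk_0E intro!: reaches_zero[of K s b] simp: zero_def)
  next
    case 2
    then have "chain (Suc 0) s v" by (auto elim!: walk_0E intro!: chain.intros)
    with assms show ?case by (auto intro: reaches_chain)
  }
next
  case (Suc k)
  {
    case 1
    then obtain q where q: "walk k s q" "meets q t" "t \<in> V" by (auto elim: walk_SucE)
    have qV: "q \<in> V" using walk_mem q by blast
    show ?case
    proof (cases "r q < l v")
      case True
      show ?thesis using Suc.IH(2)[OF q(1) 1(2) True] by (rule reaches_mono) simp
    next
      case False
      then have "meets q v" using 1 q qV span by (force simp: meets_def left_of_def)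
      then have "walk (Suc k) s v" using q 1 by (auto intro: walk.intros)
      with assms show ?thesis by (rule reaches_walk) simp
    qed
  next
    case 2
    then obtain q where q: "walk k s q" "meets q t" "t \<in> V" by (auto elim: walk_SucE)
    have qV: "q \<in> V" using walk_mem q by blast
    \<comment> \<open>\<open>q\<close> meets \<open>t\<close> and so starts before \<open>v\<close>.
      If it neither ends before \<open>v\<close> nor is \<open>left_of\<close> it, then it strictly
      contains \<open>v\<close>, and the normal form restarts at \<open>q\<close>.\<close>
    consider "r q < l v" | "left_of q v" | "nested v q"
      using q(2) 2 qV unfolding meets_def left_of_def nested_def by linarith
    then show ?case
    proof cases
      case 1
      show ?thesis using Suc.IH(2)[OF q(1) 2(2) 1] by (rule reaches_mono) simp
    next
      case 2
      show ?thesis using Suc.IH(1)[OF q(1) \<open>v \<in> V\<close> 2] by (rule reaches_mono) simp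
    next
      case 3
      have "reaches K q (b - int k)" using assms q(1) by (rule reaches_walk) simp
      then have "source K q (b - int k)" using core_nested[OF 3] by (blast intro: reaches_core)
      then show ?thesis by (rule reaches_zero) (use 3 2 in \<open>auto simp: zero_def\<close>)
    qed
  }
qed

lemma source_step:
  assumes "source K u b"
  shows "v \<in> V \<Longrightarrow> r u < l v \<Longrightarrow> reaches K v (b + 1)"
    and "v \<in> V \<Longrightarrow> zero u v \<Longrightarrow> reaches K v b"
    and "v \<in> V \<Longrightarrow> meets u v \<Longrightarrow> reaches K v (b - 1)"
proof -
  have u: "u \<in> V" using assms by (simp add: source_def)
  show "reaches K v (b + 1)" if "v \<in> V" "r u < l v"
  proof -
    have "chain (Suc 0) u v" using u that by (auto intro: chain.intros)
    with assms show ?thesis by (rule reaches_chain) simp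
  qed
  show "reaches K v b" if "v \<in> V" "zero u v" using assms that by (auto intro: reaches_zero)
  show "reaches K v (b - 1)" if "v \<in> V" "meets u v"
  proof -
    have "walk (Suc 0) u v" using u that by (auto intro: walk.intros)
    with assms show ?thesis by (rule reaches_walk) simp
  qed
qed

text \<open>The normal form absorbs one more constraint: at a vertex of \<open>core\<close> it
  restarts, and elsewhere the new step extends the current run or is merged into it.\<close>

lemma reaches_step:
  assumes R: "reaches K u x" and v: "v \<in> V"
  shows "r u < l v \<Longrightarrow> reaches K v (x + 1)"
    and "zero u v \<Longrightarrow> reaches K v x"
    and "meets u v \<Longrightarrow> reaches K v (x - 1)"
proof -
  have "(r u < l v \<longrightarrow> reaches K v (x + 1)) \<and> (zero u v \<longrightarrow> reaches K v x) \<and>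
      (meets u v \<longrightarrow> reaches K v (x - 1))"
  proof (cases "core u")
    case True
    then show ?thesis using source_step[OF reaches_core[OF R True] v] by blast
  next
    case False
    have zu: "zero u v \<longleftrightarrow> left_of u v" "zero s u \<longleftrightarrow> left_of s u" for s
      using False core_nested by (auto simp: zero_def)
    from R have uV: "u \<in> V" by (simp add: reaches_def)
    from R obtain s b where sb: "source K s b" and
      alt: "(\<exists>m. chain m s u \<and> x \<le> b + int m) \<or> (zero s u \<and> x \<le> b) \<or> (\<exists>k. walk k s u \<and> x \<le> b - int k)"
      by (auto simp: reaches_def)
    have sV: "s \<in> V" using sb by (simp add: source_def)
    consider (c) m where "chain m s u" "x \<le> b + int m" | (z) "left_of s u" "x \<le> b"
      | (w) k where "walk k s u" "x \<le> b - int k" using alt zu by blast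
    then show ?thesis
    proof cases
      case z
      have 1: "reaches K v (x + 1)" if "r u < l v"
        using source_step(1)[OF sb v] that z by (auto intro: reaches_mono simp: left_of_def)
      have 2: "reaches K v x" if "left_of u v"
        using source_step(2)[OF sb v] that z by (auto intro: reaches_mono simp: left_of_def zero_def)
      have 3: "reaches K v (x - 1)" if "meets u v"
      proof (cases "r s < l v")
        case True
        then show ?thesis using source_step(1)[OF sb v] z by (auto intro: reaches_mono)
      next
        case False
        then have "meets s v" using that z by (auto simp: meets_def left_of_def)
        then show ?thesis using source_step(3)[OF sb v] z by (auto intro: reaches_mono)
      qed
      show ?thesis using 1 2 3 zu by blast
    next
      case (w k)
      have "reaches K v (x - 1)" if "meets u v"
      proof -
        have "walk (Suc k) s v" using w v that by (auto intro: walk.intros)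
        with sb show ?thesis by (rule reaches_walk) (use w in simp)
      qed
      then show ?thesis
        using reaches_walk_step[OF sb w(1) v] zu w(2) by (auto intro: reaches_mono)
    next
      case (c m)
      show ?thesis
      proof (cases m)
        case 0
        then have "s = u" "x \<le> b" using c by (auto elim: chain_0E)
        then show ?thesis using source_step[OF sb v] by (auto intro: reaches_mono)
      next
        case (Suc n)
        with c obtain t where t: "chain n s t" "r t < l u" by (auto elim: chain_SucE)
        have tV: "t \<in> V" using t chain_mem by blast
        \<comment> \<open>Any \<open>v\<close> to the right of the predecessor \<open>t\<close> can
          take the place of \<open>u\<close> in the chain at the same weight.\<close>
        have before: "reaches K v x" if "r t < l v"
        proof -
          have "chain (Suc n) s v" using t that v by (auto intro: chain.intros)
          with sb show ?thesis by (rule reaches_chain) (use c Suc in simp)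
        qed
        have 1: "reaches K v (x + 1)" if "r u < l v"
        proof -
          have "chain (Suc m) s v" using c that v by (auto intro: chain.intros)
          with sb show ?thesis by (rule reaches_chain) (use c in simp)
        qed
        have 2: "reaches K v x" if "left_of u v" using before t that by (simp add: left_of_def)
        have 3: "reaches K v (x - 1)" if m: "meets u v"
        proof -
          have "r t < r v" using m t by (simp add: meets_def)
          \<comment> \<open>The \<open>+1\<close> step from \<open>t\<close> to \<open>u\<close> has
            to cancel against the \<open>-1\<close> step to \<open>v\<close>. If \<open>v\<close> is
            neither right of \<open>t\<close> nor above it in \<open>left_of\<close>, it strictly
            contains \<open>t\<close>, and the walk restarts at \<open>t\<close>.\<close>
          then consider "r t < l v" | "l t \<le> l v" "r t \<le> r v" | "nested t v"
            using v tV unfolding nested_def by linarith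
          then show ?thesis
          proof cases
            case 1
            then show ?thesis using before by (auto intro: reaches_mono)
          next
            case 2
            show ?thesis
            proof (cases n)
              case 0
              then have "s = t" using t by (auto elim: chain_0E)
              then show ?thesis using source_step(2)[OF sb v] 2 c Suc 0
                by (auto simp: zero_def left_of_def intro: reaches_mono)
            next
              case (Suc n')
              with t obtain q where "chain n' s q" "r q < l t" by (auto elim: chain_SucE)
              then have "chain n s v" using Suc 2 v by (auto intro: chain.intros)
              with sb show ?thesis by (rule reaches_chain) (use c \<open>m = Suc n\<close> in simp)
            qed
          next
            case 3
            have "reaches K t (x - 1)" using sb t(1) by (rule reaches_chain) (use c Suc in simp)
            then have "source K t (x - 1)" using core_nested[OF 3] by (blast intro: reaches_core)
            then show ?thesis using source_step(2) 3 v by (auto simp: zero_def)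
          qed
        qed
        show ?thesis using 1 2 3 zu by blast
      qed
    qed
  qed
  then show "r u < l v \<Longrightarrow> reaches K v (x + 1)" "zero u v \<Longrightarrow> reaches K v x"
    "meets u v \<Longrightarrow> reaches K v (x - 1)" by auto
qed

lemma forced_reaches: "forced v x \<Longrightarrow> N \<ge> 0 \<Longrightarrow> reaches K v x"
proof (induction rule: forced.induct)
  case (start v)
  then have "source K v 0" using K[of v] by (auto simp: source_def)
  moreover have "chain 0 v v" using start by (auto intro: chain.intros)
  ultimately show ?case by (rule reaches_chain) simp
qed (auto intro: reaches_step simp: zero_def nested_def)

lemma reaches_bounded:
  assumes "reaches K v x" "\<And>v. v \<in> V \<Longrightarrow> \<psi> v + K \<le> M" "0 \<le> M"
  shows "x \<le> M + N"
proof -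
  obtain s b where sb: "source K s b" and v: "v \<in> V" and
    alt: "(\<exists>m. chain m s v \<and> x \<le> b + int m) \<or> (zero s v \<and> x \<le> b) \<or> (\<exists>k. walk k s v \<and> x \<le> b - int k)"
    using assms by (auto simp: reaches_def)
  have s: "s \<in> V" using sb by (simp add: source_def)
  then have "b \<le> M" using sb assms(2)[OF s] assms(3) by (auto simp: source_def split: if_splits)
  moreover have "int m \<le> N" if "chain m s v" for m
    using chain_length[OF that] N[OF s v] by simp
  moreover have "0 \<le> N" using N[OF s s] by simp
  ultimately show ?thesis using alt by fastforce
qed

end

lemma int_image_bound:
  obtains M :: int where "\<And>v. v \<in> V \<Longrightarrow> \<bar>g v\<bar> \<le> M" "0 \<le> M"
proof
  show "\<bar>g v\<bar> \<le> (\<Sum>v\<in>V. \<bar>g v\<bar>)" if "v \<in> V" for v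
    using finite_V that by (intro member_le_sum) auto
qed (simp add: sum_nonneg)

lemma ex_order_labelling: "\<exists>f. order_labelling V l r f"
proof -
  obtain N0 where N0: "\<And>v. v \<in> V \<Longrightarrow> \<bar>l v\<bar> \<le> N0" "0 \<le> N0" using int_image_bound by blast
  obtain P where P: "\<And>v. v \<in> V \<Longrightarrow> \<bar>\<psi> v\<bar> \<le> P" "0 \<le> P" using int_image_bound by blast
  define N K where "N = 2 * N0" and "K = N + P"
  have N: "l v - l u \<le> N" if "u \<in> V" "v \<in> V" for u v using N0(1)[OF that(1)] N0(1)[OF that(2)] by (simp add: N_def)
  have K: "N \<le> \<psi> v + K" if "v \<in> V" for v using P(1)[OF that] by (simp add: K_def)
  have M: "\<psi> v + K \<le> P + K" if "v \<in> V" for v using P(1)[OF that] by simp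
  have nn: "0 \<le> N" "0 \<le> P + K" using N0 P by (auto simp: N_def K_def)
  have bound: "x \<le> P + K + N" if "forced v x" for v x
    by (rule reaches_bounded[OF N K forced_reaches[OF N K that nn(1)] M nn(2)])
  \<comment> \<open>The weight of a heaviest constraint walk ending at \<open>v\<close>. The
    restriction to \<open>0 \<le> x\<close> makes the set finite, and \<open>start\<close> puts 0
    into it.\<close>
  define f where "f v = Max {x. forced v x \<and> 0 \<le> x}" for v
  have fin: "finite {x. forced v x \<and> 0 \<le> x}" for v
    by (rule finite_subset[of _ "{0..P + K + N}"]) (use bound in auto)
  have f_ge: "x \<le> f v" if "forced v x" "v \<in> V" for v x
  proof (cases "0 \<le> x")
    case True
    then show ?thesis unfolding f_def using fin that by (intro Max_ge) auto
  next
    case False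
    have "0 \<le> f v" unfolding f_def using fin start[OF that(2)] by (intro Max_ge) auto
    then show ?thesis using False by simp
  qed
  have f_forced: "forced v (f v)" if "v \<in> V" for v
  proof -
    have "f v \<in> {x. forced v x \<and> 0 \<le> x}"
      unfolding f_def using fin start[OF that] by (intro Max_in) auto
    then show ?thesis by simp
  qed
  have "order_labelling V l r f"
    unfolding order_labelling_def
  proof (intro ballI conjI impI)
    fix u v assume uv: "u \<in> V" "v \<in> V"
    show "f u < f v" if "r u < l v"
      using f_ge[OF before[OF f_forced[OF uv(1)] uv(2) that] uv(2)] by simp
    show "f u \<le> f v + 1" if "l u \<le> r v \<and> l v \<le> r u"
      using f_ge[OF meet[OF f_forced[OF uv(1)] uv(2)] uv(2)] that by (simp add: meets_def)
    show "f u \<le> f v" if "l u \<le> l v \<and> r u \<le> r v"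
      using f_ge[OF left[OF f_forced[OF uv(1)] uv(2)] uv(2)] that by (simp add: left_of_def)
    show "f u = f v" if "l v < l u \<and> r u < r v"
    proof -
      have n: "nested u v" using uv that by (simp add: nested_def)
      show ?thesis using f_ge[OF inside[OF f_forced[OF uv(2)] n] uv(1)]
        f_ge[OF outside[OF f_forced[OF uv(1)] n] uv(2)] by simp
    qed
  qed
  then show ?thesis by blast
qed

end

subsection \<open>Levels and nested intervals\<close>

text \<open>\<open>level_clique\<close>, applied in both orders, makes each level a clique. The last
  two assumptions come from the maximality of neighbouring cliques and will supply the leaves of
  claws.\<close>

locale levels = spans V l r for V :: "'a set" and l r :: "'a \<Rightarrow> int" +
  fixes c :: "'a \<Rightarrow> int"
  assumes level_step: "\<And>u v. u \<in> V \<Longrightarrow> v \<in> V \<Longrightarrow> l u \<le> r v \<Longrightarrow> l v \<le> r u \<Longrightarrow> c u \<le> c v + 1"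
    and level_clique: "\<And>u v. u \<in> V \<Longrightarrow> v \<in> V \<Longrightarrow> c u = c v \<Longrightarrow> l u \<le> r v"
    and ends_before: "\<And>u v. u \<in> V \<Longrightarrow> v \<in> V \<Longrightarrow> l u < l v \<Longrightarrow> \<exists>w\<in>V. r w = l v - 1"
    and starts_after: "\<And>u v. u \<in> V \<Longrightarrow> v \<in> V \<Longrightarrow> r u < r v \<Longrightarrow> \<exists>w\<in>V. l w = r u + 1"
begin

text \<open>\<open>p\<close>, \<open>a\<close>, \<open>q\<close> are pairwise disjoint and all meet
  \<open>b\<close>: they are the leaves of a claw centred at \<open>b\<close>.\<close>

lemma nested_flanks:
  assumes "nested a b"
  obtains p q where "p \<in> V" "q \<in> V" "r p = l a - 1" "l q = r a + 1"
  using assms ends_before[of b a] starts_after[of a b] that unfolding nested_def by blast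

text \<open>Disjoint intervals cannot share a level, and the leaves are within one level of the
  centre, so they fill exactly the three levels around \<open>c b\<close>.\<close>

lemma flanks_levels:
  assumes "nested a b" "p \<in> V" "q \<in> V" "r p = l a - 1" "l q = r a + 1"
  shows "c p + c a + c q = 3 * c b"
    and "c p \<noteq> c a" "c a \<noteq> c q" "c p \<noteq> c q"
    and "{c b - 1, c b, c b + 1} \<subseteq> {c p, c a, c q}"
proof -
  have ab: "a \<in> V" "b \<in> V" "l b < l a" "r a < r b" using assms(1) by (auto simp: nested_def)
  note sp = span[OF ab(1)] span[OF ab(2)] span[OF assms(2)] span[OF assms(3)]
  show pa: "c p \<noteq> c a" using level_clique[OF ab(1) assms(2)] assms(4) by force
  show aq: "c a \<noteq> c q" using level_clique[OF assms(3) ab(1)] assms(5) by force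
  show pq: "c p \<noteq> c q" using level_clique[OF assms(3) assms(2)] sp assms(4,5) by force
  have near: "c b - 1 \<le> c x \<and> c x \<le> c b + 1" if "x \<in> V" "l x \<le> r b" "l b \<le> r x" for x
    using level_step[OF that(1) ab(2)] level_step[OF ab(2) that(1)] that by linarith
  have a: "c b - 1 \<le> c a \<and> c a \<le> c b + 1" by (rule near[OF ab(1)]) (use sp ab in linarith)+
  have p: "c b - 1 \<le> c p \<and> c p \<le> c b + 1" by (rule near[OF assms(2)]) (use sp ab assms(4) in linarith)+
  have q: "c b - 1 \<le> c q \<and> c q \<le> c b + 1" by (rule near[OF assms(3)]) (use sp ab assms(5) in linarith)+
  show "c p + c a + c q = 3 * c b" using pa aq pq a p q by presburger
  show "{c b - 1, c b, c b + 1} \<subseteq> {c p, c a, c q}"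
    unfolding insert_subset insert_iff using pa aq pq a p q by (intro conjI) (presburger | simp)+
qed

text \<open>The conditions on the flanks mention only \<open>a\<close>, so the same three levels
  average to the level of every vertex around \<open>a\<close>.\<close>

lemma nested_level_unique: "nested a b \<Longrightarrow> nested a b' \<Longrightarrow> c b = c b'"
proof -
  assume ab: "nested a b" "nested a b'"
  obtain p q where pq: "p \<in> V" "q \<in> V" "r p = l a - 1" "l q = r a + 1" using nested_flanks[OF ab(1)] .
  show "c b = c b'" using flanks_levels(1)[OF ab(1) pq] flanks_levels(1)[OF ab(2) pq] by simp
qed

text \<open>Members of a chain are disjoint and hence on distinct levels. \<open>X\<close> collects
  them together with the range of their ends, for a later count of levels.\<close>

lemma chain_levels:
  assumes "chain m u v"
  shows "\<exists>X\<subseteq>V. card X = Suc m \<and> inj_on c X \<and> (\<forall>w\<in>X. l u \<le> l w \<and> l w \<le> l v \<and> r u \<le> r w \<and> r w \<le> r v)"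
  using assms
proof (induction rule: chain.induct)
  case (chain_0 v)
  then show ?case by (intro exI[of _ "{v}"]) auto
next
  case (chain_Suc m u v w)
  then obtain X where X: "X \<subseteq> V" "card X = Suc m" "inj_on c X"
    "\<And>x. x \<in> X \<Longrightarrow> l u \<le> l x \<and> l x \<le> l v \<and> r u \<le> r x \<and> r x \<le> r v" by blast
  have V: "u \<in> V" "v \<in> V" "w \<in> V" using chain_Suc chain_mem by auto
  note sp = span[OF V(1)] span[OF V(2)] span[OF V(3)]
  have fin: "finite X" using X finite_V finite_subset by blast
  have ne: "X \<noteq> {}" using X(2) by auto
  have new: "c w \<notin> c ` X"
  proof
    assume "c w \<in> c ` X"
    then obtain x where x: "x \<in> X" "c w = c x" by auto
    have "x \<in> V" using x X by blast
    then show False using level_clique[OF V(3) _ x(2)] X(4)[OF x(1)] chain_Suc.hyps(3) by linarith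
  qed
  have b: "l u \<le> l v \<and> r u \<le> r v"
  proof -
    obtain x where "x \<in> X" using ne by blast
    from X(4)[OF this] show ?thesis by linarith
  qed
  show ?case
  proof (intro exI[of _ "insert w X"] conjI ballI)
    show "inj_on c (insert w X)" using new X by auto
    show "card (insert w X) = Suc (Suc m)" using new fin X by (subst card_insert_disjoint) auto
    have vw: "l v \<le> l w" "r v \<le> r w" using chain_Suc.hyps sp by linarith+
    fix x assume "x \<in> insert w X"
    then consider "x = w" | "x \<in> X" by blast
    then have "l u \<le> l x \<and> l x \<le> l w \<and> r u \<le> r x \<and> r x \<le> r w"
    proof cases
      case 1
      then show ?thesis using b vw by simp
    next
      case 2
      then show ?thesis using X(4)[of x] vw by linarith
    qed
    then show "l u \<le> l x" "l x \<le> l w" "r u \<le> r x" "r x \<le> r w" by auto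
  qed (use X V in auto)
qed

lemma walk_levels: "walk k u v \<Longrightarrow> \<bar>c v - c u\<bar> \<le> int k"
proof (induction rule: walk.induct)
  case (walk_Suc k u v w)
  then show ?case
    using level_step[of v w] level_step[of w v] walk_mem[of k u v] by (auto simp: meets_def)
qed auto

end

section \<open>Connected graphs: comparing the levels with the clique ordering\<close>

locale connected_levels = levels V l r c for V :: "'a set" and l r :: "'a \<Rightarrow> int" and c :: "'a \<Rightarrow> int" +
  assumes no_cut: "\<And>u v i. u \<in> V \<Longrightarrow> v \<in> V \<Longrightarrow> r u \<le> i \<Longrightarrow> i < l v \<Longrightarrow> \<exists>w\<in>V. l w \<le> i \<and> i < r w"
begin

text \<open>Turns \<open>no_cut\<close>, a statement about gaps on the line, into connectedness of
  the graph.\<close>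

lemma connected_bipartition:
  assumes "\<exists>x\<in>V. P x" "\<exists>y\<in>V. \<not> P y"
  shows "\<exists>x\<in>V. \<exists>y\<in>V. P x \<and> \<not> P y \<and> meets x y"
proof -
  have *: "\<exists>x\<in>V. \<exists>y\<in>V. P x \<and> \<not> P y \<and> meets x y"
    if u: "u \<in> V" "P u" "\<And>v. v \<in> V \<Longrightarrow> l u \<le> l v" and "\<exists>y\<in>V. \<not> P y" for u and P :: "'a \<Rightarrow> bool"
  proof -
    have "finite {y\<in>V. \<not> P y}" "{y\<in>V. \<not> P y} \<noteq> {}" using finite_V that by auto
    from arg_min_if_finite(1)[OF this, of l] arg_min_least[OF this, of _ l]
    obtain y where y: "y \<in> V" "\<not> P y" "\<And>x. x \<in> V \<Longrightarrow> \<not> P x \<Longrightarrow> l y \<le> l x" by blast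
    show ?thesis
    proof (cases "l y \<le> r u")
      case True
      then have "meets u y" using u y span[of y] by (force simp: meets_def)
      then show ?thesis using u y by blast
    next
      case False
      \<comment> \<open>A vertex crossing the gap just before \<open>y\<close> starts before
        \<open>y\<close>, so the minimality of \<open>y\<close> puts it on the side of
        \<open>P\<close>.\<close>
      then obtain w where w: "w \<in> V" "l w \<le> l y - 1" "l y - 1 < r w"
        using no_cut[of u y "l y - 1"] u y by auto
      then have "P w" using y(3)[of w] by force
      moreover have "meets w y" using w y span[of y] by (force simp: meets_def)
      ultimately show ?thesis using w y by blast
    qed
  qed
  have "V \<noteq> {}" using assms by auto
  from arg_min_if_finite(1)[OF finite_V this, of l] arg_min_least[OF finite_V this, of _ l]
  obtain u where u: "u \<in> V" "\<And>v. v \<in> V \<Longrightarrow> l u \<le> l v" by blast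
  show ?thesis
  proof (cases "P u")
    case True
    then show ?thesis using *[of u P] u assms by blast
  next
    case False
    then have "\<exists>x\<in>V. \<exists>y\<in>V. \<not> P x \<and> P y \<and> meets x y" using *[of u "\<lambda>x. \<not> P x"] u assms by blast
    then show ?thesis by (auto simp: meets_def)
  qed
qed

text \<open>Each level lies on one side of an uncovered point, so consecutive levels on different sides
  would disconnect the graph.\<close>

lemma levels_cover:
  assumes b: "b \<in> V" "b' \<in> V" "c b \<le> c b'" and i: "min (l b) (l b') \<le> i" "i \<le> max (r b) (r b')"
  shows "\<exists>w\<in>V. c b \<le> c w \<and> c w \<le> c b' \<and> l w \<le> i \<and> i \<le> r w"
proof (rule ccontr)
  assume no: "\<not> ?thesis"
  have side: "r w < i \<or> i < l w" if "w \<in> V" "c b \<le> c w" "c w \<le> c b'" for w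
    using that no not_le by blast
  have same: "r x < i \<longleftrightarrow> r y < i" if "x \<in> V" "y \<in> V" "c x = c y" "c b \<le> c x" "c x \<le> c b'" for x y
  proof -
    have "r x < i \<or> i < l x" "r y < i \<or> i < l y" using side that by auto
    moreover have "l x \<le> r y" "l y \<le> r x" using level_clique that by auto
    ultimately show ?thesis by linarith
  qed
  have diff: "r b < i \<longleftrightarrow> \<not> r b' < i"
  proof -
    have "r b < i \<or> i < l b" "r b' < i \<or> i < l b'" using side b by auto
    then show ?thesis using i span[OF b(1)] span[OF b(2)] by linarith
  qed
  define P where "P j \<longleftrightarrow> (\<forall>w\<in>V. c w = j \<longrightarrow> (r w < i \<longleftrightarrow> r b < i))" for j
  have "P j" if "c b \<le> j" "j \<le> c b'" for j
    using that
  proof (induction j rule: int_ge_induct)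
    case base
    show ?case unfolding P_def
    proof (intro ballI impI)
      fix w assume "w \<in> V" "c w = c b"
      then show "r w < i \<longleftrightarrow> r b < i" by (intro same) (use b in auto)
    qed
  next
    case (step j)
    have "\<exists>x\<in>V. c x \<le> j" "\<exists>y\<in>V. \<not> c y \<le> j"
      using b(1) step.hyps b(2) step.prems by (blast, intro bexI[of _ b'], simp_all)
    \<comment> \<open>An edge leaving the levels up to \<open>j\<close> joins level \<open>j\<close>
      to level \<open>j + 1\<close>. Its ends meet and both avoid \<open>i\<close>, so they lie on
      the same side of \<open>i\<close>.\<close>
    then obtain x y where xy: "x \<in> V" "y \<in> V" "c x \<le> j" "\<not> c y \<le> j" "meets x y"
      using connected_bipartition[of "\<lambda>x. c x \<le> j"] by blast
    then have cxy: "c x = j" "c y = j + 1" using level_step[of y x] by (auto simp: meets_def)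
    have x: "r x < i \<longleftrightarrow> r b < i" using step cxy xy unfolding P_def by auto
    have "r x < i \<or> i < l x" "r y < i \<or> i < l y" using side xy cxy step.hyps step.prems by auto
    then have xy_side: "r x < i \<longleftrightarrow> r y < i" using xy(5) unfolding meets_def by linarith
    show ?case unfolding P_def
    proof (intro ballI impI)
      fix w assume w: "w \<in> V" "c w = j + 1"
      have "r w < i \<longleftrightarrow> r y < i" using same[OF w(1) xy(2)] w(2) cxy step.hyps step.prems by simp
      then show "r w < i \<longleftrightarrow> r b < i" using x xy_side by blast
    qed
  qed
  then have "P (c b')" using b by simp
  then have "r b' < i \<longleftrightarrow> r b < i" using b(2) unfolding P_def by blast
  then show False using diff by blast
qed

text \<open>By \<open>levels_cover\<close> some vertex of intermediate level passes through
  \<open>i\<close>; it meets \<open>x\<close>, so their levels differ by at most one.\<close>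

lemma level_near:
  assumes "a \<in> V" "b \<in> V" "x \<in> V" "l x \<le> i" "i \<le> r x"
    "min (l a) (l b) \<le> i" "i \<le> max (r a) (r b)"
  shows "min (c a) (c b) - 1 \<le> c x \<and> c x \<le> max (c a) (c b) + 1"
proof -
  have *: "c a - 1 \<le> c x \<and> c x \<le> c b + 1"
    if ab: "a \<in> V" "b \<in> V" "min (l a) (l b) \<le> i" "i \<le> max (r a) (r b)" "c a \<le> c b" for a b
  proof -
    obtain w where w: "w \<in> V" "c a \<le> c w" "c w \<le> c b" "l w \<le> i" "i \<le> r w"
      using levels_cover[OF ab(1,2,5,3,4)] by blast
    then show ?thesis using level_step[OF w(1) assms(3)] level_step[OF assms(3) w(1)] assms(4,5) by linarith
  qed
  show ?thesis
  proof (cases "c a \<le> c b")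
    case True
    then show ?thesis using *[OF assms(1,2,6,7)] by linarith
  next
    case False
    then have "c b - 1 \<le> c x \<and> c x \<le> c a + 1"
      using assms by (intro *) (auto simp: min.commute max.commute)
    with False show ?thesis by linarith
  qed
qed

text \<open>The claw leaves \<open>p\<close>, \<open>d\<close>, \<open>q\<close> all reach into the
  hull of \<open>a\<close> and \<open>b\<close>, so their levels leave the range by at most one.
  Since they include \<open>c D - 1\<close> and \<open>c D + 1\<close>, the centre stays within the
  range.\<close>

lemma nested_between:
  assumes "nested d D" "a \<in> V" "b \<in> V" "min (l a) (l b) < l d" "r d < max (r a) (r b)"
  shows "min (c a) (c b) \<le> c D \<and> c D \<le> max (c a) (c b)"
proof -
  obtain p q where pq: "p \<in> V" "q \<in> V" "r p = l d - 1" "l q = r d + 1"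
    using nested_flanks[OF assms(1)] .
  have d: "d \<in> V" using assms(1) by (simp add: nested_def)
  note sp = span[OF d] span[OF pq(1)] span[OF pq(2)]
  let ?near = "\<lambda>x. min (c a) (c b) - 1 \<le> c x \<and> c x \<le> max (c a) (c b) + 1"
  have "?near p"
    by (rule level_near[OF assms(2,3) pq(1), of "l d - 1"]) (use assms(4,5) sp pq in linarith)+
  moreover have "?near d"
    by (rule level_near[OF assms(2,3) d, of "l d"]) (use assms(4,5) sp in linarith)+
  moreover have "?near q"
    by (rule level_near[OF assms(2,3) pq(2), of "r d + 1"]) (use assms(4,5) sp pq in linarith)+
  moreover have "c D - 1 \<in> c ` {p, d, q}" "c D + 1 \<in> c ` {p, d, q}"
    using flanks_levels(5)[OF assms(1) pq] by auto
  ultimately have "min (c a) (c b) - 1 \<le> c D - 1" "c D + 1 \<le> max (c a) (c b) + 1"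
    by fastforce+
  then show ?thesis by linarith
qed

text \<open>Flanks prolong the chain at both ends, which yields \<open>m + 3\<close> distinct
  levels. All are within one of the range between \<open>c A\<close> and \<open>c B\<close>, and the
  range so widened has three levels more than the distance.\<close>

lemma chain_level_distance:
  assumes "nested a A" "nested b B" "chain m a b"
  shows "int m \<le> \<bar>c B - c A\<bar>"
proof -
  obtain p q where p: "p \<in> V" "r p = l a - 1" using nested_flanks[OF assms(1)] by metis
  obtain q where q: "q \<in> V" "l q = r b + 1" using nested_flanks[OF assms(2)] by metis
  have V: "A \<in> V" "B \<in> V" "l A < l a" "r b < r B" "a \<in> V" "b \<in> V" using assms by (auto simp: nested_def)
  note sp = span[OF V(5)] span[OF V(6)] span[OF p(1)] span[OF q(1)]
  have "chain (Suc m) a q" using assms(3) q by (auto intro: chain.intros)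
  then have "chain (Suc (Suc m)) p q" by (rule chain_prepend) (use p in auto)
  from chain_levels[OF this] obtain X where X: "X \<subseteq> V" "card X = m + 3" "inj_on c X"
    "\<And>w. w \<in> X \<Longrightarrow> l w \<le> l q \<and> r p \<le> r w" by auto
  have ab: "l a \<le> l b" using chain_length[OF assms(3)] by simp
  let ?m = "min (c A) (c B)" and ?M = "max (c A) (c B)"
  have "c ` X \<subseteq> {?m - 1..?M + 1}"
  proof
    fix y assume "y \<in> c ` X"
    then obtain w where w: "w \<in> X" "y = c w" by auto
    then have wV: "w \<in> V" using X by auto
    show "y \<in> {?m - 1..?M + 1}"
      unfolding w(2) atLeastAtMost_iff
      \<comment> \<open>\<open>w\<close> may start outside the hull of \<open>A\<close> and
        \<open>B\<close>; the point just before \<open>a\<close> lies in the hull and is still at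
        most \<open>r w\<close>.\<close>
      by (rule level_near[OF V(1,2) wV, of "max (l w) (l a - 1)"])
        (use X(4)[OF w(1)] span[OF wV] V p q ab sp in linarith)+
  qed
  then have "card (c ` X) \<le> card {?m - 1..?M + 1}" by (intro card_mono) auto
  then have "m + 3 \<le> card {?m - 1..?M + 1}" using X by (simp add: card_image)
  then show ?thesis by auto
qed

text \<open>The sign is read off from the leftmost and the rightmost nested vertex; every other one lies
  between these two.\<close>

lemma nested_orientation:
  "\<exists>\<sigma>::int. \<bar>\<sigma>\<bar> = 1 \<and> (\<forall>a A b B. nested a A \<longrightarrow> nested b B \<longrightarrow> left_of a b \<longrightarrow> \<sigma> * c A \<le> \<sigma> * c B)"
proof (cases "{a. \<exists>A. nested a A} = {}")
  case True
  then show ?thesis by (intro exI[of _ 1]) auto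
next
  case False
  have fin: "finite {a. \<exists>A. nested a A}"
    by (rule finite_subset[OF _ finite_V]) (auto simp: nested_def)
  from arg_min_if_finite(1)[OF fin False, of l] arg_min_least[OF fin False, of _ l]
  obtain e E where e: "nested e E" "\<And>d D. nested d D \<Longrightarrow> l e \<le> l d" by blast
  from arg_min_if_finite(1)[OF fin False, of "\<lambda>a. - r a"] arg_min_least[OF fin False, of _ "\<lambda>a. - r a"]
  obtain f F where f: "nested f F" "\<And>d D. nested d D \<Longrightarrow> r d \<le> r f" by auto
  have btw: "min (c A) (c B) \<le> c D \<and> c D \<le> max (c A) (c B)"
    if "nested a A" "nested b B" "nested d D" "l a \<le> l d" "r d \<le> r b" for a A b B d D
  proof (rule nested_between[OF that(3)])
    have "l A < l a" "r b < r B" using that(1,2) by (auto simp: nested_def)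
    then show "min (l A) (l B) < l d" "r d < max (r A) (r B)" using that(4,5) by linarith+
  qed (use that(1,2) in \<open>auto simp: nested_def\<close>)
  have "(if c E \<le> c F then 1 else - 1) * c A \<le> (if c E \<le> c F then 1 else - 1) * c B"
    if "nested a A" "nested b B" "left_of a b" for a A b B
  proof -
    have "min (c E) (c F) \<le> c B \<and> c B \<le> max (c E) (c F)"
      using btw[OF e(1) f(1) that(2)] e(2)[OF that(2)] f(2)[OF that(2)] by blast
    moreover have "min (c E) (c B) \<le> c A \<and> c A \<le> max (c E) (c B)"
      using btw[OF e(1) that(2) that(1)] e(2)[OF that(1)] that(3) by (auto simp: left_of_def)
    ultimately have "c E \<le> c F \<Longrightarrow> c A \<le> c B" "\<not> c E \<le> c F \<Longrightarrow> c B \<le> c A" by linarith+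
    then show ?thesis by simp
  qed
  then show ?thesis by (intro exI[of _ "if c E \<le> c F then 1 else - 1"]) auto
qed

text \<open>The level of the claw centre: a centre keeps its own level, and any other nested vertex
  takes that of a vertex around it, well defined by \<open>nested_level_unique\<close>.\<close>

definition core_level :: "'a \<Rightarrow> int" where
  "core_level v = (if \<exists>a. nested a v then c v else c (SOME b. nested v b))"

lemma core_level_outer: "nested a b \<Longrightarrow> core_level b = c b"
  by (auto simp: core_level_def)

lemma nested_trans: "nested a b \<Longrightarrow> nested b d \<Longrightarrow> nested a d"
  by (auto simp: nested_def)

text \<open>If \<open>a\<close> is a centre as well, an interval nested in \<open>a\<close> is also
  nested in \<open>b\<close>, so uniqueness equates \<open>c a\<close> and
  \<open>c b\<close>.\<close>

lemma core_level_inner: "nested a b \<Longrightarrow> core_level a = c b"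
  unfolding core_level_def
  by (metis (full_types) nested_level_unique nested_trans someI_ex)

lemma core_cases:
  assumes "core s"
  obtains a A where "nested a A" "core_level s = c A" "s = a \<or> s = A"
  using assms core_level_inner core_level_outer unfolding core_def by metis

lemma core_potential_exists: "\<exists>\<psi>. core_potential V l r \<psi>"
proof -
  obtain \<sigma> :: int where \<sigma>: "\<bar>\<sigma>\<bar> = 1" and
    mono: "\<And>a A b B. nested a A \<Longrightarrow> nested b B \<Longrightarrow> left_of a b \<Longrightarrow> \<sigma> * c A \<le> \<sigma> * c B"
    using nested_orientation by blast
  have sgn: "\<sigma> = 1 \<or> \<sigma> = - 1" using \<sigma> by linarith
  have "core_potential V l r (\<lambda>v. \<sigma> * core_level v)"
  proof
    show "\<sigma> * core_level a = \<sigma> * core_level b" if "nested a b" for a b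
      using that core_level_inner core_level_outer by simp
    show "\<sigma> * core_level s \<le> \<sigma> * core_level t" if st: "core s" "core t" "left_of s t" for s t
    proof -
      obtain a A where a: "nested a A" "core_level s = c A" "s = a \<or> s = A" using core_cases[OF st(1)] .
      obtain b B where b: "nested b B" "core_level t = c B" "t = b \<or> t = B" using core_cases[OF st(2)] .
      \<comment> \<open>If the inner intervals are not ordered like \<open>s\<close> and
        \<open>t\<close>, one of them is nested in the opposite core vertex too, and uniqueness
        makes the two potentials equal.\<close>
      consider "left_of a b" | "nested a t" | "nested b s"
        using a b st(3) unfolding left_of_def nested_def by smt
      then show ?thesis
      proof cases
        case 1
        then show ?thesis using mono a b by simp
      next
        case 2
        have "c t = core_level t" using core_level_outer[OF 2] by simp
        then show ?thesis using nested_level_unique[OF 2 a(1)] a by simp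
      next
        case 3
        have "c s = core_level s" using core_level_outer[OF 3] by simp
        then show ?thesis using nested_level_unique[OF 3 b(1)] b by simp
      qed
    qed
    show "\<sigma> * core_level s + int m \<le> \<sigma> * core_level t" if st: "core s" "core t" "chain m s t" for s t m
    proof (cases m)
      case 0
      then show ?thesis using st by (auto elim: chain_0E)
    next
      case (Suc n)
      obtain a A where a: "nested a A" "core_level s = c A" "s = a \<or> s = A" using core_cases[OF st(1)] .
      obtain b B where b: "nested b B" "core_level t = c B" "t = b \<or> t = B" using core_cases[OF st(2)] .
      have V: "a \<in> V" "b \<in> V" "r a \<le> r s" "l t \<le> l b" using a b by (auto simp: nested_def)
      \<comment> \<open>Shrinking both ends to the inner intervals preserves a chain of positive
        length.\<close>
      have "chain m s b"
        using st(3) V unfolding Suc by (auto elim!: chain_SucE intro!: chain_Suc)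
      then have ch: "chain m a b" using V(1,3) unfolding Suc by (rule chain_start)
      have "left_of a b"
        using chain_before[of n a b] ch span[OF V(1)] span[OF V(2)] by (auto simp: Suc left_of_def)
      then have "\<sigma> * c A \<le> \<sigma> * c B" using mono a b by blast
      then show ?thesis using chain_level_distance[OF a(1) b(1) ch] a(2) b(2) sgn by auto
    qed
    show "\<sigma> * core_level s - int k \<le> \<sigma> * core_level t" if st: "core s" "core t" "walk k s t" for s t k
    proof (cases k)
      case 0
      then show ?thesis using st by (auto elim: walk_0E)
    next
      case (Suc n)
      obtain a A where a: "nested a A" "core_level s = c A" "s = a \<or> s = A" using core_cases[OF st(1)] .
      obtain b B where b: "nested b B" "core_level t = c B" "t = b \<or> t = B" using core_cases[OF st(2)] .
      have V: "A \<in> V" "B \<in> V" "l A \<le> l s" "r s \<le> r A" "l B \<le> l t" "r t \<le> r B"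
        using a b by (auto simp: nested_def)
      \<comment> \<open>Enlarging both ends to the outer intervals preserves a walk, and there the
        potential is, up to sign, the level itself.\<close>
      have "walk k s B"
        using st(3) V unfolding Suc by (auto elim!: walk_SucE intro!: walk_Suc simp: meets_def)
      then have "walk k A B" using V(1,3,4) unfolding Suc by (rule walk_start)
      then show ?thesis using walk_levels[of k A B] a(2) b(2) sgn by auto
    qed
  qed
  then show ?thesis by blast
qed

lemma ex_order_labelling: "\<exists>f. order_labelling V l r f"
  using core_potential_exists core_potential.ex_order_labelling by blast

end

text \<open>The sign may differ between components, so a disconnected graph is cut at an uncrossed
  gap and the labellings of the two sides are stacked.\<close>

lemma levels_order_labelling: "levels V l r c \<Longrightarrow> \<exists>f. order_labelling V l r f"
proof (induction "card V" arbitrary: V rule: less_induct)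
  case less
  interpret levels V l r c by fact
  show ?case
  proof (cases "connected_levels V l r c")
    case True
    then show ?thesis by (rule connected_levels.ex_order_labelling)
  next
    case False
    then obtain x y i where xy: "x \<in> V" "y \<in> V" "r x \<le> i" "i < l y"
      and cut: "\<And>w. w \<in> V \<Longrightarrow> l w \<le> i \<Longrightarrow> r w \<le> i"
      unfolding connected_levels_def connected_levels_axioms_def
      using levels_axioms by force
    define A B where "A = {v\<in>V. r v \<le> i}" and "B = {v\<in>V. i < l v}"
    have V: "V = A \<union> B" using cut by (force simp: A_def B_def)
    have AB: "x \<in> A" "y \<notin> A" "x \<notin> B" "y \<in> B"
      using xy span[of x] span[of y] by (auto simp: A_def B_def)
    \<comment> \<open>The flanking vertices stay on their side because no interval crosses the
      gap.\<close>
    have "levels A l r c"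
    proof
      show "\<exists>w\<in>A. r w = l v - 1" if "u \<in> A" "v \<in> A" "l u < l v" for u v
        using ends_before[of u v] that span[of v] by (force simp: A_def)
      show "\<exists>w\<in>A. l w = r u + 1" if "u \<in> A" "v \<in> A" "r u < r v" for u v
        using starts_after[of u v] that cut by (force simp: A_def)
    qed (use finite_V span level_step level_clique in \<open>auto simp: A_def\<close>)
    moreover have "levels B l r c"
    proof
      show "\<exists>w\<in>B. r w = l v - 1" if "u \<in> B" "v \<in> B" "l u < l v" for u v
        using ends_before[of u v] that cut by (force simp: B_def)
      show "\<exists>w\<in>B. l w = r u + 1" if "u \<in> B" "v \<in> B" "r u < r v" for u v
        using starts_after[of u v] that span[of u] by (force simp: B_def)
    qed (use finite_V span level_step level_clique in \<open>auto simp: B_def\<close>)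
    moreover have "card A < card V" "card B < card V"
      using AB V xy finite_V by (auto intro!: psubset_card_mono)
    ultimately obtain f g where f: "order_labelling A l r f" and g: "order_labelling B l r g"
      using less.hyps by blast
    define k where "k = (\<Sum>v\<in>V. \<bar>f v\<bar> + \<bar>g v\<bar>)"
    have k: "\<bar>f v\<bar> + \<bar>g v\<bar> \<le> k" if "v \<in> V" for v
      unfolding k_def by (rule member_le_sum[OF that, of "\<lambda>v. \<bar>f v\<bar> + \<bar>g v\<bar>"]) (auto simp: finite_V)
    \<comment> \<open>\<open>k\<close> bounds both labellings in absolute value, so this shift lifts
      every label on \<open>B\<close> above every label on \<open>A\<close>.\<close>
    define h where "h v = (if v \<in> A then f v else g v + 2 * k + 1)" for v
    have AB': "u \<in> A \<Longrightarrow> v \<in> B \<Longrightarrow> h u < h v \<and> r u < l v" for u v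
      using k[of u] k[of v] span[of v] by (auto simp: h_def A_def B_def)
    have hB: "h v = g v + 2 * k + 1" if "v \<in> B" for v
      using that span[of v] by (auto simp: h_def A_def B_def)
    have "order_labelling V l r h"
      unfolding order_labelling_def
    proof (intro ballI)
      fix u v assume uv: "u \<in> V" "v \<in> V"
      consider "u \<in> A" "v \<in> A" | "u \<in> B" "v \<in> B" | "u \<in> A" "v \<in> B" | "u \<in> B" "v \<in> A" using V uv by auto
      then show "(r u < l v \<longrightarrow> h u < h v) \<and> (l u \<le> r v \<and> l v \<le> r u \<longrightarrow> h u \<le> h v + 1) \<and>
         (l u \<le> l v \<and> r u \<le> r v \<longrightarrow> h u \<le> h v) \<and> (l v < l u \<and> r u < r v \<longrightarrow> h u = h v)"
      proof cases
        case 1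
        then show ?thesis using f by (auto simp: order_labelling_def h_def)
      next
        case 2
        then have "(r u < l v \<longrightarrow> g u < g v) \<and> (l u \<le> r v \<and> l v \<le> r u \<longrightarrow> g u \<le> g v + 1) \<and>
          (l u \<le> l v \<and> r u \<le> r v \<longrightarrow> g u \<le> g v) \<and> (l v < l u \<and> r u < r v \<longrightarrow> g u = g v)"
          using g unfolding order_labelling_def by blast
        then show ?thesis using hB[OF 2(1)] hB[OF 2(2)] by auto
      next
        case 3
        then show ?thesis using AB'[of u v] span[OF uv(1)] span[OF uv(2)] by auto
      next
        case 4
        then show ?thesis using AB'[of v u] span[OF uv(1)] span[OF uv(2)] by auto
      qed
    qed
    then show ?thesis by blast
  qed
qed

subsection \<open>Exact hitting sets\<close>

text \<open>The point hitting the vertices labelled \<open>j\<close> is the first one that is to the right of all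
  their left ends and of all intervals with a smaller label. That it misses the label \<open>j + 1\<close> is
  where the additional point between consecutive gadgets is needed.\<close>

lemma exact_hitting_set_of_labelling:
  fixes a b f :: "'a \<Rightarrow> int"
  assumes fin: "finite V"
    and a_mono: "\<And>u v. u \<in> V \<Longrightarrow> v \<in> V \<Longrightarrow> a u \<le> a v \<Longrightarrow> f u \<le> f v"
    and b_mono: "\<And>u v. u \<in> V \<Longrightarrow> v \<in> V \<Longrightarrow> b u \<le> b v \<Longrightarrow> f u \<le> f v"
    and same: "\<And>u v. u \<in> V \<Longrightarrow> v \<in> V \<Longrightarrow> f u = f v \<Longrightarrow> a u \<le> b v"
    and far: "\<And>u v. u \<in> V \<Longrightarrow> v \<in> V \<Longrightarrow> f u + 2 \<le> f v \<Longrightarrow> b u + 1 < a v"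
  shows "\<exists>T \<subseteq> (\<Union>v\<in>V. {a v..b v}). \<forall>v\<in>V. card (T \<inter> {a v..b v}) = 1"
proof -
  define A where "A v = a ` {w\<in>V. f w = f v} \<union> (\<lambda>w. b w + 1) ` {w\<in>V. f w < f v}" for v
  define t where "t v = Max (A v)" for v
  have A: "finite (A v)" "a v \<in> A v" if "v \<in> V" for v using fin that by (auto simp: A_def)
  have t_in: "a v \<le> t v \<and> t v \<le> b v" if v: "v \<in> V" for v
  proof
    show "a v \<le> t v" unfolding t_def by (rule Max_ge[OF A[OF v]])
    have "x \<le> b v" if x: "x \<in> A v" for x
    proof -
      from x consider w where "w \<in> V" "f w = f v" "x = a w"
        | w where "w \<in> V" "f w < f v" "x = b w + 1" by (auto simp: A_def)
      then show ?thesis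
      proof cases
        case 1
        then show ?thesis using same[OF _ v] by blast
      next
        case 2
        then show ?thesis using b_mono[OF v, of w] by linarith
      qed
    qed
    then show "t v \<le> b v" unfolding t_def using Max_in[of "A v"] A[OF v] by blast
  qed
  have unique: "t u = t v" if u: "u \<in> V" and v: "v \<in> V" and mem: "a v \<le> t u" "t u \<le> b v" for u v
  proof -
    consider "f v < f u" | "f u < f v" | "f u = f v" by linarith
    then show ?thesis
    proof cases
      case 1
      then have "b v + 1 \<in> A u" using v by (auto simp: A_def)
      then have "b v + 1 \<le> t u" unfolding t_def using A(1)[OF u] by simp
      then show ?thesis using mem by simp
    next
      case 2
      have "x < a v" if x: "x \<in> A u" for x
      proof -
        from x consider w where "w \<in> V" "f w = f u" "x = a w"
          | w where "w \<in> V" "f w < f u" "x = b w + 1" by (auto simp: A_def)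
        then show ?thesis
        proof cases
          case 1
          then show ?thesis using 2 a_mono[OF v, of w] by linarith
        next
          case 2
          then show ?thesis using \<open>f u < f v\<close> far[OF _ v, of w] by linarith
        qed
      qed
      then have "t u < a v" unfolding t_def using Max_in[of "A u"] A[OF u] by blast
      then show ?thesis using mem by simp
    qed (simp add: t_def A_def)
  qed
  have "t ` V \<inter> {a v..b v} = {t v}" if "v \<in> V" for v
  proof
    show "t ` V \<inter> {a v..b v} \<subseteq> {t v}"
      unfolding atLeastAtMost_def using unique[OF _ that] by blast
    show "{t v} \<subseteq> t ` V \<inter> {a v..b v}" using that t_in[OF that] by simp
  qed
  moreover have "t ` V \<subseteq> (\<Union>v\<in>V. {a v..b v})" using t_in by auto
  ultimately show ?thesis by (intro exI[of _ "t ` V"]) simp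
qed

section \<open>Positions in the endpoint lists\<close>

lemma list_position_nth:
  assumes "v \<in> set xs"
  shows "list_position xs v \<le> length xs" "xs ! (list_position xs v - 1) = v"
proof -
  have "length (takeWhile (\<lambda>u. u \<noteq> v) xs) < length xs"
    using assms by (induction xs) auto
  then show "list_position xs v \<le> length xs" "xs ! (list_position xs v - 1) = v"
    using nth_length_takeWhile[of "\<lambda>u. u \<noteq> v" xs] by (auto simp: list_position_def)
qed

lemma list_position_pos: "1 \<le> list_position xs v"
  by (simp add: list_position_def)

lemma sorted_wrt_list_position:
  assumes "sorted_wrt P xs" "u \<in> set xs" "v \<in> set xs" "list_position xs u \<le> list_position xs v"
  shows "u = v \<or> P u v"
proof (cases "list_position xs u = list_position xs v")
  case True
  then show ?thesis using list_position_nth(2) assms(2,3) by metis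
next
  case False
  then have "P (xs ! (list_position xs u - 1)) (xs ! (list_position xs v - 1))"
    using assms list_position_nth(1)[OF assms(3)] list_position_pos[of xs u]
    by (intro sorted_wrt_nth_less[OF assms(1)]) linarith+
  then show ?thesis using list_position_nth(2) assms(2,3) by metis
qed

section \<open>Maximal cliques in a consecutive ordering\<close>

lemma clique_extends:
  assumes "finite V" "clique V E C"
  shows "\<exists>D. maximal_clique V E D \<and> C \<subseteq> D"
proof -
  have "finite {D. clique V E D}"
    by (rule finite_subset[of _ "Pow V"]) (use assms(1) in \<open>auto simp: clique_def\<close>)
  from finite_has_maximal2[OF this, of C] assms(2) show ?thesis
    unfolding maximal_clique_def by blast
qed

locale clique_ordering =
  fixes V :: "'a set" and E :: "'a set set" and n :: nat and Q :: "nat \<Rightarrow> 'a set"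
  assumes finite_V: "finite V"
    and ordering: "consecutive_clique_ordering V E n Q"
begin

abbreviation "first \<equiv> first_clique n Q"
abbreviation "final \<equiv> last_clique n Q"

lemma bij_Q: "bij_betw Q {1..n} {C. maximal_clique V E C}"
  using ordering by (simp add: consecutive_clique_ordering_def)

lemma maximal_Q: "i \<in> {1..n} \<Longrightarrow> maximal_clique V E (Q i)"
  using bij_betwE[OF bij_Q] by simp

lemma maximal_is_Q: "maximal_clique V E C \<Longrightarrow> \<exists>i\<in>{1..n}. C = Q i"
  using bij_betw_imp_surj_on[OF bij_Q] by blast

lemma Q_subset: "i \<in> {1..n} \<Longrightarrow> Q i \<subseteq> V"
  using maximal_Q[of i] by (simp add: maximal_clique_def clique_def)

lemma Q_not_subset:
  assumes "i \<in> {1..n}" "j \<in> {1..n}" "i \<noteq> j"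
  obtains v where "v \<in> Q i" "v \<notin> Q j"
proof -
  have "Q i \<noteq> Q j"
    using bij_betw_imp_inj_on[OF bij_Q] assms by (simp add: inj_on_eq_iff)
  then have "\<not> Q i \<subseteq> Q j" using maximal_Q[OF assms(1)] maximal_Q[OF assms(2)]
    unfolding maximal_clique_def by metis
  then show ?thesis using that by blast
qed

lemma occurs:
  assumes "v \<in> V"
  shows "\<exists>i\<in>{1..n}. v \<in> Q i"
proof -
  have "clique V E {v}" using assms by (simp add: clique_def)
  then obtain C where "maximal_clique V E C" "v \<in> C" using clique_extends[OF finite_V] by blast
  then show ?thesis using maximal_is_Q by blast
qed

lemma ends_in_range:
  assumes "v \<in> V"
  shows "first v \<in> {1..n}" "final v \<in> {1..n}" "v \<in> Q (first v)" "v \<in> Q (final v)" "first v \<le> final v"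
proof -
  let ?S = "{i \<in> {1..n}. v \<in> Q i}"
  have S: "finite ?S" "?S \<noteq> {}" using occurs[OF assms] by auto
  have m: "first v \<in> ?S" "final v \<in> ?S"
    unfolding first_clique_def last_clique_def using Min_in[OF S] Max_in[OF S] by blast+
  then show "first v \<in> {1..n}" "final v \<in> {1..n}" "v \<in> Q (first v)" "v \<in> Q (final v)" by blast+
  show "first v \<le> final v"
    using Min_le[OF S(1) m(2)] by (simp only: first_clique_def)
qed

lemma mem_Q_iff:
  assumes "v \<in> V" "i \<in> {1..n}"
  shows "v \<in> Q i \<longleftrightarrow> first v \<le> i \<and> i \<le> final v"
proof
  assume "v \<in> Q i"
  then have "i \<in> {i \<in> {1..n}. v \<in> Q i}" using assms(2) by blast
  then show "first v \<le> i \<and> i \<le> final v"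
    unfolding first_clique_def last_clique_def by (simp add: Min_le Max_ge)
next
  assume i: "first v \<le> i \<and> i \<le> final v"
  have "\<forall>i j k. 1 \<le> i \<and> i \<le> j \<and> j \<le> k \<and> k \<le> n \<and> v \<in> Q i \<and> v \<in> Q k \<longrightarrow> v \<in> Q j"
    using ordering assms(1) unfolding consecutive_clique_ordering_def by blast
  from this[rule_format, of "first v" i "final v"] show "v \<in> Q i"
    using i ends_in_range[OF assms(1)] by simp
qed

text \<open>An edge is a clique and so lies inside some \<open>Q i\<close>; conversely, the larger
  of the two first indices is that of a common clique.\<close>

lemma edge_iff:
  assumes "u \<in> V" "v \<in> V" "u \<noteq> v"
  shows "{u, v} \<in> E \<longleftrightarrow> first u \<le> final v \<and> first v \<le> final u"
proof
  assume "{u, v} \<in> E"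
  then have "clique V E {u, v}" using assms by (auto simp: clique_def insert_commute)
  then obtain i where "i \<in> {1..n}" "u \<in> Q i" "v \<in> Q i"
    using clique_extends[OF finite_V] maximal_is_Q by (metis insert_subset)
  then show "first u \<le> final v \<and> first v \<le> final u" using mem_Q_iff assms by fastforce
next
  assume meet: "first u \<le> final v \<and> first v \<le> final u"
  let ?i = "max (first u) (first v)"
  have i: "?i \<in> {1..n}" using ends_in_range assms by (simp add: max_def)
  have "u \<in> Q ?i" "v \<in> Q ?i"
    using mem_Q_iff[OF assms(1) i] mem_Q_iff[OF assms(2) i] meet ends_in_range(5) assms by auto
  then show "{u, v} \<in> E"
    using maximal_Q[OF i] assms(3) by (auto simp: maximal_clique_def clique_def)
qed

text \<open>\<open>Q i\<close> is not contained in \<open>Q (Suc i)\<close>, and by consecutiveness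
  a vertex that drops out there never returns.\<close>

lemma ex_final:
  assumes "i \<in> {1..<n}"
  shows "\<exists>w\<in>V. final w = i"
proof -
  have i: "i \<in> {1..n}" "Suc i \<in> {1..n}" using assms by auto
  then obtain w where w: "w \<in> Q i" "w \<notin> Q (Suc i)" using Q_not_subset by (metis n_not_Suc_n)
  then have "w \<in> V" using Q_subset i by blast
  then show ?thesis using w mem_Q_iff[of w] i by (intro bexI[of _ w]) (auto simp: not_less_eq_eq le_Suc_eq)
qed

lemma ex_first_Suc:
  assumes "i \<in> {1..<n}"
  shows "\<exists>w\<in>V. first w = Suc i"
proof -
  have i: "i \<in> {1..n}" "Suc i \<in> {1..n}" using assms by auto
  then obtain w where w: "w \<in> Q (Suc i)" "w \<notin> Q i" using Q_not_subset by (metis n_not_Suc_n)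
  then have "w \<in> V" using Q_subset i by blast
  then show ?thesis using w mem_Q_iff[of w] i by (intro bexI[of _ w]) (auto simp: le_Suc_eq)
qed

lemma Q_nonempty:
  assumes "v \<in> V" "i \<in> {1..n}"
  obtains w where "w \<in> V" "w \<in> Q i"
proof -
  have "clique V E {v}" using assms by (simp add: clique_def)
  then have "Q i \<noteq> {}" using maximal_Q[OF assms(2)] by (auto simp: maximal_clique_def)
  then show ?thesis using that Q_subset[OF assms(2)] by blast
qed

text \<open>The level is the rank of the hit point. Vertices with the same hit point meet there, and
  a third hit point strictly between those of two meeting intervals would hit one of them
  twice.\<close>

lemma levels_of_exact_hitting:
  assumes "exactly_hittable_graph V E"
  shows "\<exists>c. levels V (\<lambda>v. int (first v)) (\<lambda>v. int (final v)) c"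
proof -
  obtain I T where I: "interval_representation V E I" and T: "\<And>v. v \<in> V \<Longrightarrow> card (T \<inter> I v) = 1"
    using assms by (auto simp: exactly_hittable_graph_def)
  define t where "t v = (THE x. T \<inter> I v = {x})" for v
  have t: "T \<inter> I v = {t v}" if "v \<in> V" for v
  proof -
    obtain x where "T \<inter> I v = {x}" using T[OF \<open>v \<in> V\<close>] by (rule card_1_singletonE)
    then show ?thesis by (simp add: t_def)
  qed
  \<comment> \<open>Only points hitting some vertex are counted, so the rank is finite and
    neighbouring hit points get consecutive levels whatever else \<open>T\<close> contains.\<close>
  define c where "c v = int (card {x \<in> t ` V. x \<le> t v})" for v
  have fin: "finite {x \<in> t ` V. P x}" for P using finite_V by auto
  have c_less: "c u < c v" if "t u < t v" "v \<in> V" for u v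
  proof -
    have "{x \<in> t ` V. x \<le> t u} \<subseteq> {x \<in> t ` V. x \<le> t v}" using that(1) by auto
    moreover have "t v \<in> {x \<in> t ` V. x \<le> t v}" "t v \<notin> {x \<in> t ` V. x \<le> t u}" using that by auto
    ultimately have "{x \<in> t ` V. x \<le> t u} \<subset> {x \<in> t ` V. x \<le> t v}" by blast
    then show ?thesis unfolding c_def by (simp add: psubset_card_mono fin)
  qed
  have c_eq: "t u = t v" if "c u = c v" "u \<in> V" "v \<in> V" for u v
    using c_less[of u v] c_less[of v u] that by linarith
  have c_le: "c u \<le> c v" if "t u \<le> t v" for u v
  proof -
    have "{x \<in> t ` V. x \<le> t u} \<subseteq> {x \<in> t ` V. x \<le> t v}" using that by auto
    then show ?thesis unfolding c_def by (simp add: card_mono fin)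
  qed
  have edges: "\<forall>u\<in>V. \<forall>v\<in>V. u \<noteq> v \<longrightarrow> ({u, v} \<in> E \<longleftrightarrow> I u \<inter> I v \<noteq> {})"
    using I unfolding interval_representation_def by (rule conjunct2)
  have intervals: "\<forall>v\<in>V. integer_interval (I v)"
    using I unfolding interval_representation_def by (rule conjunct1)
  have meets: "I u \<inter> I v \<noteq> {} \<longleftrightarrow> first u \<le> final v \<and> first v \<le> final u" if "u \<in> V" "v \<in> V" for u v
  proof (cases "u = v")
    case True
    moreover have "I v \<noteq> {}" using t[OF that(2)] by blast
    ultimately show ?thesis using ends_in_range(5)[OF that(2)] by simp
  next
    case False
    have "{u, v} \<in> E \<longleftrightarrow> I u \<inter> I v \<noteq> {}"
      using edges[rule_format, OF that False] .
    then show ?thesis using edge_iff[OF that False] by simp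
  qed
  have convex: "y \<in> I v" if "v \<in> V" "p \<in> I v" "q \<in> I v" "p \<le> y" "y \<le> q" for v p q y
  proof -
    have "integer_interval (I v)" using intervals that(1) by blast
    then obtain a b where "I v = {a..b}" unfolding integer_interval_def by blast
    then show ?thesis using that(2-5) by simp
  qed
  have "levels V (\<lambda>v. int (first v)) (\<lambda>v. int (final v)) c"
  proof
    fix u v assume uv: "u \<in> V" "v \<in> V"
    show "int (first u) \<le> int (final v)" if "c u = c v"
    proof -
      have "t u \<in> I u" "t v \<in> I v" using t[OF uv(1)] t[OF uv(2)] by blast+
      then have "I u \<inter> I v \<noteq> {}" using c_eq[OF that uv] by auto
      then show ?thesis using meets[OF uv] by simp
    qed
    show "c u \<le> c v + 1" if "int (first u) \<le> int (final v)" "int (first v) \<le> int (final u)"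
    proof (rule ccontr)
      assume far: "\<not> c u \<le> c v + 1"
      have "I u \<inter> I v \<noteq> {}" using meets[OF uv] that by simp
      then obtain x where x: "x \<in> I u" "x \<in> I v" by blast
      \<comment> \<open>The ranks differ by at least two, so a hit point other than
        \<open>t u\<close> lies between \<open>t v\<close> and \<open>t u\<close>.\<close>
      have "\<not> {y \<in> t ` V. y \<le> t u} \<subseteq> insert (t u) {y \<in> t ` V. y \<le> t v}"
      proof
        assume "{y \<in> t ` V. y \<le> t u} \<subseteq> insert (t u) {y \<in> t ` V. y \<le> t v}"
        then have "card {y \<in> t ` V. y \<le> t u} \<le> card (insert (t u) {y \<in> t ` V. y \<le> t v})"
          by (intro card_mono) (use fin in auto)
        also have "\<dots> \<le> Suc (card {y \<in> t ` V. y \<le> t v})" by (rule card_insert_le_m1) auto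
        finally show False using far unfolding c_def by linarith
      qed
      then obtain y where "y \<in> t ` V" "y \<le> t u" "y \<noteq> t u" "\<not> y \<le> t v" by blast
      then obtain w where w: "w \<in> V" "t v < t w" "t w < t u" by force
      have "t w \<in> T" "t u \<in> I u" "t v \<in> I v" using t[OF w(1)] t[OF uv(1)] t[OF uv(2)] by blast+
      \<comment> \<open>The intervals share \<open>x\<close>, so together they cover everything from
        \<open>t v\<close> to \<open>t u\<close>.\<close>
      moreover have "t w \<in> I v \<or> t w \<in> I u"
      proof (cases "t w \<le> x")
        case True
        then show ?thesis using convex[OF uv(2) \<open>t v \<in> I v\<close> x(2)] w by simp
      next
        case False
        then show ?thesis using convex[OF uv(1) x(1) \<open>t u \<in> I u\<close>] w by simp
      qed
      ultimately have "t w \<in> {t v} \<union> {t u}" using t[OF uv(1)] t[OF uv(2)] by blast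
      then show False using w by simp
    qed
    show "\<exists>w\<in>V. int (final w) = int (first v) - 1" if "int (first u) < int (first v)"
    proof -
      have "first v - 1 \<in> {1..<n}"
        using ends_in_range(1)[OF uv(1)] ends_in_range(1)[OF uv(2)] that by auto
      then obtain w where "w \<in> V" "final w = first v - 1" using ex_final by blast
      then show ?thesis using that by (intro bexI[of _ w]) auto
    qed
    show "\<exists>w\<in>V. int (first w) = int (final u) + 1" if "int (final u) < int (final v)"
    proof -
      have "final u \<in> {1..<n}"
        using ends_in_range(2)[OF uv(1)] ends_in_range(2)[OF uv(2)] that by auto
      then obtain w where "w \<in> V" "first w = Suc (final u)" using ex_first_Suc by blast
      then show ?thesis by (intro bexI[of _ w]) auto
    qed
  qed (simp_all add: finite_V ends_in_range(5))
  then show ?thesis by blast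
qed

end

section \<open>Geometry of the gadgets and stretched intervals\<close>

locale canonical_representation = clique_ordering V E n Q
  for V :: "'a set" and E n Q +
  fixes L R :: "nat \<Rightarrow> 'a list" and z :: "nat \<Rightarrow> int"
  assumes starts: "start_lists V n Q L"
    and ends: "end_lists V n Q R"
    and placed: "gadget_placement n L R z"
begin

abbreviation "left_end v \<equiv> z (first v) - int (list_position (L (first v)) v) + 1"
abbreviation "right_end v \<equiv> z (final v) + int (list_position (R (final v)) v) - 1"

text \<open>Every index is the first of some vertex and the last of some vertex, so neither list is
  empty. The vertex \<open>v\<close> excludes the empty graph, whose only maximal clique is
  empty.\<close>

lemma gadget_bounds:
  assumes "v \<in> V" "i \<in> {1..n}"
  shows "gadget_left L z i \<le> z i" "z i \<le> gadget_right R z i"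
proof -
  have "\<exists>w\<in>V. first w = i"
  proof (cases "i = 1")
    case True
    obtain w where "w \<in> V" "w \<in> Q i" using Q_nonempty[OF assms] .
    then show ?thesis using True assms(2) ends_in_range(1)[of w] mem_Q_iff[of w i] by (intro bexI[of _ w]) auto
  next
    case False
    then have "i - 1 \<in> {1..<n}" "Suc (i - 1) = i" using assms(2) by auto
    then show ?thesis using ex_first_Suc[of "i - 1"] by simp
  qed
  then have "L i \<noteq> []" using starts assms(2) by (force simp: start_lists_def)
  then show "gadget_left L z i \<le> z i" by (cases "L i") (auto simp: gadget_left_def)
  have "\<exists>w\<in>V. final w = i"
  proof (cases "i = n")
    case True
    obtain w where "w \<in> V" "w \<in> Q i" using Q_nonempty[OF assms] .
    then show ?thesis using True assms(2) ends_in_range(2)[of w] mem_Q_iff[of w i] by (intro bexI[of _ w]) auto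
  next
    case False
    then show ?thesis using ex_final[of i] assms(2) by auto
  qed
  then have "R i \<noteq> []" using ends assms(2) by (force simp: end_lists_def)
  then show "z i \<le> gadget_right R z i" by (cases "R i") (auto simp: gadget_right_def)
qed

text \<open>The 2 accounts for the additional point; the gadgets in between are nonempty and only
  widen the gap.\<close>

lemma gadget_separated:
  assumes "v \<in> V" "i < j" "1 \<le> i" "j \<le> n"
  shows "gadget_right R z i + 2 \<le> gadget_left L z j"
  using assms(2,4)
proof (induction j)
  case (Suc j)
  have next_left: "gadget_left L z (Suc j) = gadget_right R z j + 2"
    using placed Suc.prems assms(3) by (auto simp: gadget_placement_def)
  show ?case
  proof (cases "i = j")
    case False
    then show ?thesis
      using Suc next_left gadget_bounds[OF assms(1), of j] assms(3) by force
  qed (use next_left in simp)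
qed simp

lemma zero_mono:
  assumes "v \<in> V" "i \<le> j" "1 \<le> i" "j \<le> n"
  shows "z i \<le> z j"
proof (cases "i = j")
  case False
  then show ?thesis
    using gadget_separated[OF assms(1), of i j] gadget_bounds[OF assms(1), of i]
      gadget_bounds[OF assms(1), of j] assms by force
qed simp

lemma end_bounds:
  assumes "v \<in> V"
  shows "gadget_left L z (first v) \<le> left_end v" "left_end v \<le> z (first v)"
    "z (final v) \<le> right_end v" "right_end v \<le> gadget_right R z (final v)"
proof -
  have "v \<in> set (L (first v))" "v \<in> set (R (final v))"
    using starts ends ends_in_range[OF assms] assms by (auto simp: start_lists_def end_lists_def)
  from list_position_nth(1)[OF this(1)] list_position_nth(1)[OF this(2)]
    list_position_pos[of "L (first v)" v] list_position_pos[of "R (final v)" v]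
  show "gadget_left L z (first v) \<le> left_end v" "left_end v \<le> z (first v)"
    "z (final v) \<le> right_end v" "right_end v \<le> gadget_right R z (final v)"
    by (auto simp: gadget_left_def gadget_right_def)
qed

text \<open>Left ends lie at or before their zero points and right ends at or after theirs, so it
  suffices to compare zero points.\<close>

lemma meeting_ends:
  assumes "u \<in> V" "v \<in> V" "first u \<le> final v"
  shows "left_end u \<le> right_end v"
  using end_bounds[OF assms(1)] end_bounds[OF assms(2)] zero_mono[OF assms(1,3)]
    ends_in_range[OF assms(1)] ends_in_range[OF assms(2)] by auto

lemma separated_ends:
  assumes "u \<in> V" "v \<in> V" "final u < first v"
  shows "right_end u + 2 \<le> left_end v"
  using end_bounds[OF assms(1)] end_bounds[OF assms(2)] gadget_separated[OF assms(1,3)]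
    ends_in_range[OF assms(1)] ends_in_range[OF assms(2)] by auto

lemma left_end_order:
  assumes "u \<in> V" "v \<in> V" "left_end u \<le> left_end v"
  shows "first u \<le> first v" "first u = first v \<Longrightarrow> final u \<le> final v"
proof -
  note b = end_bounds[OF assms(1)] end_bounds[OF assms(2)]
  note i = ends_in_range[OF assms(1)] ends_in_range[OF assms(2)]
  show "first u \<le> first v"
  proof (rule ccontr)
    assume "\<not> ?thesis"
    then have "gadget_right R z (first v) + 2 \<le> gadget_left L z (first u)"
      using i by (intro gadget_separated[OF assms(1)]) auto
    then show False using b gadget_bounds(2)[OF assms(2), of "first v"] i assms(3) by simp
  qed
  assume eq: "first u = first v"
  have "sorted_wrt (\<lambda>u v. final v \<le> final u) (L (first v))" "u \<in> set (L (first v))" "v \<in> set (L (first v))"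
    using starts i eq assms by (auto simp: start_lists_def)
  \<comment> \<open>A later position in \<open>L\<close> is further left, so \<open>u\<close> and
    \<open>v\<close> exchange roles here.\<close>
  from sorted_wrt_list_position[OF this(1,3,2)] eq assms(3) show "final u \<le> final v" by auto
qed

lemma right_end_order:
  assumes "u \<in> V" "v \<in> V" "right_end u \<le> right_end v"
  shows "final u \<le> final v" "final u = final v \<Longrightarrow> first u \<le> first v"
proof -
  note b = end_bounds[OF assms(1)] end_bounds[OF assms(2)]
  note i = ends_in_range[OF assms(1)] ends_in_range[OF assms(2)]
  show "final u \<le> final v"
  proof (rule ccontr)
    assume "\<not> ?thesis"
    then have "gadget_right R z (final v) + 2 \<le> gadget_left L z (final u)"
      using i by (intro gadget_separated[OF assms(1)]) auto
    then show False using b gadget_bounds(1)[OF assms(1), of "final u"] i assms(3) by simp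
  qed
  assume eq: "final u = final v"
  have "sorted_wrt (\<lambda>u v. first u \<le> first v) (R (final v))" "u \<in> set (R (final v))" "v \<in> set (R (final v))"
    using ends i eq assms by (auto simp: end_lists_def)
  from sorted_wrt_list_position[OF this] eq assms(3) show "first u \<le> first v" by auto
qed

lemma stretched_interval_eq: "stretched_interval n Q L R z v = {left_end v..right_end v}"
  by (simp add: stretched_interval_def)

text \<open>The additional points fill the gaps between gadgets, so no hole remains.\<close>

lemma canonical_points_cover:
  assumes "1 \<le> i" "i \<le> n"
  shows "{gadget_left L z 1..gadget_right R z i} \<subseteq> canonical_points n L R z"
  using assms
proof (induction i rule: nat_induct_at_least)
  case base
  then show ?case by (auto simp: canonical_points_def gadget_def)
next
  case (Suc i)
  have next_left: "gadget_left L z (Suc i) = gadget_right R z i + 2"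
    using placed Suc by (auto simp: gadget_placement_def)
  show ?case
  proof
    fix x assume x: "x \<in> {gadget_left L z 1..gadget_right R z (Suc i)}"
    consider "x \<le> gadget_right R z i" | "x = gadget_right R z i + 1" | "x \<ge> gadget_left L z (Suc i)"
      using next_left by linarith
    then show "x \<in> canonical_points n L R z"
    proof cases
      case 1
      then show ?thesis using Suc x by auto
    next
      case 2
      then show ?thesis using Suc by (auto simp: canonical_points_def)
    next
      case 3
      then have "x \<in> gadget L R z (Suc i)" using x by (auto simp: gadget_def)
      then show ?thesis using Suc.prems by (auto simp: canonical_points_def)
    qed
  qed
qed

lemma stretched_interval_points:
  assumes "v \<in> V"
  shows "{left_end v..right_end v} \<subseteq> canonical_points n L R z"
proof -
  note i = ends_in_range[OF assms]
  have "gadget_left L z 1 \<le> gadget_left L z (first v)"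
  proof (cases "first v = 1")
    case False
    then show ?thesis
      using gadget_separated[OF assms, of 1 "first v"] gadget_bounds[OF assms, of 1] i by force
  qed simp
  then show ?thesis
    using canonical_points_cover[of "final v"] i end_bounds[OF assms] by fastforce
qed

lemma interval_representation_stretched: "interval_representation V E (stretched_interval n Q L R z)"
  unfolding interval_representation_def
proof (intro conjI ballI impI)
  show "integer_interval (stretched_interval n Q L R z v)" if "v \<in> V" for v
    using meeting_ends[OF that that] ends_in_range(5)[OF that]
    unfolding integer_interval_def stretched_interval_eq by blast
  fix u v assume uv: "u \<in> V" "v \<in> V" "u \<noteq> v"
  have "left_end u \<le> right_end u" "left_end v \<le> right_end v"
    using meeting_ends uv ends_in_range(5) by blast+
  then have "{left_end u..right_end u} \<inter> {left_end v..right_end v} \<noteq> {} \<longleftrightarrow>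
      left_end u \<le> right_end v \<and> left_end v \<le> right_end u"
    unfolding Int_atLeastAtMost by auto
  also have "\<dots> \<longleftrightarrow> first u \<le> final v \<and> first v \<le> final u"
    using meeting_ends[OF uv(1,2)] meeting_ends[OF uv(2,1)]
      separated_ends[OF uv(1,2)] separated_ends[OF uv(2,1)] by (meson add_le_same_cancel1 not_le_imp_less order_trans zle_add1_eq_le not_numeral_le_zero)
  finally show "{u, v} \<in> E \<longleftrightarrow> stretched_interval n Q L R z u \<inter> stretched_interval n Q L R z v \<noteq> {}"
    using edge_iff[OF uv] stretched_interval_eq by simp
qed

lemma exactly_hittable_iff:
  "exactly_hittable_graph V E \<longleftrightarrow>
    exactly_hittable_hypergraph (canonical_points n L R z) (canonical_hyperedges V n Q L R z)"
proof
  assume "exactly_hittable_hypergraph (canonical_points n L R z) (canonical_hyperedges V n Q L R z)"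
  then show "exactly_hittable_graph V E"
    unfolding exactly_hittable_hypergraph_def exactly_hittable_graph_def canonical_hyperedges_def
    by (elim exE conjE) (intro exI conjI, rule interval_representation_stretched, blast)
next
  assume "exactly_hittable_graph V E"
  then obtain f where f: "order_labelling V (\<lambda>v. int (first v)) (\<lambda>v. int (final v)) f"
    using levels_of_exact_hitting levels_order_labelling by blast
  have lab: "final u < first v \<Longrightarrow> f u < f v" "first u \<le> final v \<Longrightarrow> first v \<le> final u \<Longrightarrow> f u \<le> f v + 1"
    "first u \<le> first v \<Longrightarrow> final u \<le> final v \<Longrightarrow> f u \<le> f v"
    "first v < first u \<Longrightarrow> final u < final v \<Longrightarrow> f u = f v"
    if "u \<in> V" "v \<in> V" for u v
    using f[unfolded order_labelling_def, rule_format, OF that] by simp_all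
  have "\<exists>T \<subseteq> (\<Union>v\<in>V. {left_end v..right_end v}). \<forall>v\<in>V. card (T \<inter> {left_end v..right_end v}) = 1"
  proof (rule exact_hitting_set_of_labelling[where f = f])
    fix u v assume uv: "u \<in> V" "v \<in> V"
    \<comment> \<open>Either \<open>u\<close> is weakly left of \<open>v\<close> in both indices, or
      \<open>v\<close> is strictly nested in \<open>u\<close> and the labels agree. For right ends,
      the second case has \<open>u\<close> nested in \<open>v\<close>.\<close>
    show "f u \<le> f v" if "left_end u \<le> left_end v"
      using left_end_order[OF uv that] lab(3)[OF uv] lab(4)[OF uv(2,1)] by linarith
    show "f u \<le> f v" if "right_end u \<le> right_end v"
      using right_end_order[OF uv that] lab(3)[OF uv] lab(4)[OF uv] by linarith
    show "left_end u \<le> right_end v" if "f u = f v"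
      using meeting_ends[OF uv] lab(1)[OF uv(2,1)] that by linarith
    \<comment> \<open>Labels two apart exclude an edge, and their order excludes that
      \<open>v\<close> comes first.\<close>
    show "right_end u + 1 < left_end v" if "f u + 2 \<le> f v"
      using separated_ends[OF uv] lab(1)[OF uv(2,1)] lab(2)[OF uv(2,1)] that by linarith
  qed (rule finite_V)
  then obtain T where T: "T \<subseteq> (\<Union>v\<in>V. {left_end v..right_end v})"
    "\<And>v. v \<in> V \<Longrightarrow> card (T \<inter> {left_end v..right_end v}) = 1" by blast
  have "T \<subseteq> canonical_points n L R z" using T(1) stretched_interval_points by blast
  then show "exactly_hittable_hypergraph (canonical_points n L R z) (canonical_hyperedges V n Q L R z)"
    unfolding exactly_hittable_hypergraph_def canonical_hyperedges_def
    using T(2) by (intro exI[of _ T]) (simp add: stretched_interval_eq)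
qed

end

theorem theorem2:
  fixes V :: "'a set" and E :: "'a set set"
    and r :: nat and Q :: "nat \<Rightarrow> 'a set"
    and L R :: "nat \<Rightarrow> 'a list" and z :: "nat \<Rightarrow> int"
  assumes "finite_simple_graph V E"
    and "interval_graph V E"
    and "consecutive_clique_ordering V E r Q"
    and "start_lists V r Q L"
    and "end_lists V r Q R"
    and "gadget_placement r L R z"
  shows "exactly_hittable_graph V E \<longleftrightarrow>
    exactly_hittable_hypergraph (canonical_points r L R z) (canonical_hyperedges V r Q L R z)"
proof -
  interpret canonical_representation V E r Q L R z
    using assms by unfold_locales (simp_all add: finite_simple_graph_def)
  show ?thesis by (rule exactly_hittable_iff)
qed

end
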